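(* Let $\mathcal{X}$ be a Polish space and $P(\tau,x,t,\cdot)$ the transition probabilities of an inhomogeneous Markov process on $\mathcal{X}$. Let $V:\mathcal{X}\to[0,\infty]$ be a Borel measurable function such that: (A1) $\{x:V(x)<\infty\}$ is nonempty, and there exist $0<\gamma<1$ and $C>0$ such that for any $x\in\mathcal{X}$ and $n\in\mathbb{Z}$, $\int_{\mathcal{X}}V(y)P(n-1,x,n,dy)\le\gamma V(x)+C$; (A2) for any $R>0$ there exist $n_0=n_0(R)\in\mathbb{N}^+$ and $0<\delta=\delta(R)<1$ such that for any $n\in\mathbb{Z}$, $$\sup_{(x,y):\,V(x)+V(y)\le R}\|P(n-n_0,x,n,\cdot)-P(n-n_0,y,n,\cdot)\|_{TV}\le 2(1-\delta).$$ Then, for the unique sequence of probability measures $\{\mu_n\}_{n\in\mathbb{Z}}$ on $\mathcal{X}$ which satisfies $\int_{\mathcal{X}}V\,d\mu_n<+\infty$ for all $n\in\mathbb{Z}$ and $\int_{\mathcal{X}}f\,d(P^{\ast}_{m,n}\mu_m)=\int_{\mathcal{X}}f\,d\mu_n$ for all $m<n$ in $\mathbb{Z}$ and all measurable $f$ with $\|f\|\le 1$, the following hold: (i) there exist constants $0<\alpha<1$ and $M>0$ such that $$\Big\|\int_{\mathcal{X}}\varphi(y)P(n-m,\cdot,n,dy)-\int_{\mathcal{X}}\varphi(y)\mu_n(dy)\Big\|\le M\alpha^{m}\Big\|\varphi-\int_{\mathcal{X}}\varphi(y)\mu_n(dy)\Big\|$$ for any $n\in\mathbb{Z}$, $m\in\mathbb{N}$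 and any bounded measurable function $\varphi:\mathcal{X}\to\mathbb{R}$; (ii) there exist constants $0<\alpha<1$ and $\tilde{M}>0$ such that $$\|P(n-m,x,n,\cdot)-\mu_n\|_{TV}\le\tilde{M}\alpha^{m}(1+V(x))$$ for any $n\in\mathbb{Z}$, $m\in\mathbb{N}$ and $x\in\mathcal{X}$.
   Context: $\mathbb{N}=\{0,1,2,\dots\}$, $\mathbb{N}^+=\{1,2,\dots\}$. $\mathcal{X}$ carries its Borel $\sigma$-field. The transition probabilities $P(\tau,x,t,\cdot)$ ($\tau\le t$ real, $x\in\mathcal{X}$; only integer times enter this statement) are Borel probability measures, measurable in $x$, with $P(t,x,t,\cdot)=\delta_x$, satisfying the Chapman–Kolmogorov equations $P(s,x,t,A)=\int_{\mathcal{X}}P(\tau,y,t,A)P(s,x,\tau,dy)$ for $s\le\tau\le t$. Transition operators: $P^{\ast}_{\tau,t}\nu(A)=\int_{\mathcal{X}}P(\tau,x,t,A)\,\nu(dx)$ for probability measures $\nu$. Total variation norm of a finite signed measure $\mu$: $\|\mu\|_{TV}=\sup\{|\int\phi\,d\mu|:\phi\text{ measurable},\ \sup|\phi|\le 1\}$ (so the difference of two probability measures has norm at most $2$). Weighted supremum norm with respect to $V$: $\|\varphi\|:=\sup_{x\in\mathcal{X}}\frac{|\varphi(x)|}{1+V(x)}$ (quotients with infinite denominator are $0$).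
   Formalization: Sequences with each ∫V dμ_n finite need not be unique (Ornstein–Uhlenbeck, V=|x|, μ_n=N(ce^{-n},1/2)); proved instead: a sequence with sup_n ∫V dμ_n<∞ exists, is unique among such sequences, and satisfies (i) and (ii). *)

theory Defs
  imports "HOL-Probability.Probability"
begin

text \<open>
  \<open>P s x t\<close> is the law at time \<open>t\<close> of the process started from \<open>x\<close> at time \<open>s\<close>. Measurability into
  \<open>prob_algebra borel\<close> says that every \<open>P s x t\<close> is a Borel probability measure and that
  \<open>x \<mapsto> P s x t A\<close> is measurable for every Borel set \<open>A\<close>. Nothing is required when \<open>s > t\<close>.
\<close>

locale transition_probabilities =
  fixes P :: "real \<Rightarrow> 'a::polish_space \<Rightarrow> real \<Rightarrow> 'a measure"
  assumes kernel: "s \<le> t \<Longrightarrow> (\<lambda>x. P s x t) \<in> borel \<rightarrow>\<^sub>M prob_algebra borel"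
    and initial: "P t x t = return borel x"
    and chapman_kolmogorov:
      "s \<le> r \<Longrightarrow> r \<le> t \<Longrightarrow> A \<in> sets borel \<Longrightarrow>
        emeasure (P s x t) A = (\<integral>\<^sup>+ y. emeasure (P r y t) A \<partial>P s x r)"

definition transition_op ::
    "(real \<Rightarrow> 'a::polish_space \<Rightarrow> real \<Rightarrow> 'a measure) \<Rightarrow> real \<Rightarrow> real \<Rightarrow> 'a measure \<Rightarrow> 'a measure" where
  "transition_op P s t \<nu> = \<nu> \<bind> (\<lambda>x. P s x t)"

lemma (in transition_probabilities) emeasure_transition_op:
  assumes "s \<le> t" "prob_space \<nu>" "sets \<nu> = sets borel" "A \<in> sets borel"
  shows "emeasure (transition_op P s t \<nu>) A = (\<integral>\<^sup>+ x. emeasure (P s x t) A \<partial>\<nu>)"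
proof -
  have "\<nu> \<in> space (prob_algebra borel)"
    using assms by (simp add: space_prob_algebra)
  then show ?thesis
    unfolding transition_op_def
    using assms kernel[OF assms(1)] by (rule_tac emeasure_bind_prob_algebra) auto
qed

text \<open>
  The total variation norm of the signed measure \<open>\<mu> - \<nu>\<close>, for finite measures \<open>\<mu>\<close> and \<open>\<nu>\<close> on the
  Borel sets: integration against \<open>\<mu> - \<nu>\<close> is the difference of the two integrals.
\<close>

definition tv_norm_diff :: "'a::topological_space measure \<Rightarrow> 'a measure \<Rightarrow> ennreal" where
  "tv_norm_diff \<mu> \<nu> =
     (SUP \<phi> \<in> {\<phi> :: 'a \<Rightarrow> real. \<phi> \<in> borel_measurable borel \<and> (\<forall>x. \<bar>\<phi> x\<bar> \<le> 1)}.
        ennreal \<bar>(\<integral>x. \<phi> x \<partial>\<mu>) - (\<integral>x. \<phi> x \<partial>\<nu>)\<bar>)"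

text \<open>Division by \<open>\<infinity>\<close> yields \<open>0\<close> in \<^typ>\<open>ennreal\<close>, so points with \<open>V x = \<infinity>\<close> do not contribute.\<close>

definition weighted_norm :: "('a \<Rightarrow> ennreal) \<Rightarrow> ('a \<Rightarrow> real) \<Rightarrow> ennreal" where
  "weighted_norm V \<phi> = (SUP x. ennreal \<bar>\<phi> x\<bar> / (1 + V x))"

definition invariant_sequence ::
    "(real \<Rightarrow> 'a::polish_space \<Rightarrow> real \<Rightarrow> 'a measure) \<Rightarrow> ('a \<Rightarrow> ennreal) \<Rightarrow> (int \<Rightarrow> 'a measure) \<Rightarrow> bool"
  where
  "invariant_sequence P V \<mu> \<longleftrightarrow>
     (\<forall>n. prob_space (\<mu> n) \<and> sets (\<mu> n) = sets borel) \<and>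
     (\<forall>n. (\<integral>\<^sup>+ x. V x \<partial>\<mu> n) < \<infinity>) \<and>
     (\<forall>m n. m < n \<longrightarrow>
        (\<forall>f \<in> borel_measurable borel. weighted_norm V f \<le> 1 \<longrightarrow>
           (\<integral>x. f x \<partial>transition_op P m n (\<mu> m)) = (\<integral>x. f x \<partial>\<mu> n)))"

text \<open>
  \<^const>\<open>invariant_sequence\<close> alone need not determine the sequence. For the Ornstein-Uhlenbeck
  process, \<open>P s x t = N(exp (s - t) * x, (1 - exp (2 * (s - t))) / 2)\<close>, and \<open>V x = \<bar>x\<bar>\<close>, the laws
  \<open>\<mu> n = N(c * exp (- n), 1/2)\<close> form an invariant sequence for every real \<open>c\<close>, and only \<open>c = 0\<close>
  keeps the integrals of \<open>V\<close> bounded as \<open>n\<close> tends to \<open>-\<infinity>\<close>. Uniqueness is therefore meant among the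
  invariant sequences whose \<open>V\<close>-integrals are bounded in \<open>n\<close>. When there is only one invariant
  sequence altogether, it is the same one.
\<close>

definition bounded_V_moments :: "('a \<Rightarrow> ennreal) \<Rightarrow> (int \<Rightarrow> 'a measure) \<Rightarrow> bool" where
  "bounded_V_moments V \<mu> \<longleftrightarrow> (SUP n. \<integral>\<^sup>+ x. V x \<partial>\<mu> n) < \<infinity>"

end

theory Submission imports Defs begin

text \<open>
  A function-side version of Hairer and Mattingly's proof of Harris' theorem. For a small \<open>\<beta> > 0\<close>,
  consider on bounded measurable functions the seminorm
  \<open>sup \<bar>\<phi> x - \<phi> y\<bar> / (2 + \<beta> * V x + \<beta> * V y)\<close>, the supremum being over points where \<open>V\<close> is finite.
  Up to an additive constant such a function is bounded by a multiple of \<open>1 + \<beta> * V\<close>. Hence the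
  transition operator over \<open>n0\<close> time steps contracts the seminorm: where \<open>V x + V y\<close> is large the drift
  condition gains a factor, and where it is small the part of \<open>\<phi>\<close> bounded by a constant is contracted
  by the minorization condition and the rest is of order \<open>\<beta>\<close>. The contraction, which is uniform in
  time, makes the laws at time \<open>n\<close> of the processes started ever earlier from a point with \<open>V\<close> finite
  converge in total variation to \<open>\<mu> n\<close>. Integrating the contraction estimate in \<open>y\<close> against
  \<open>\<mu> (n - m)\<close> gives both rates of convergence, and hence uniqueness.
\<close>

section \<open>Integrals and limits of probability measures\<close>

lemma (in prob_space) integrable_bounded:
  fixes f :: "'a \<Rightarrow> real"
  assumes "f \<in> borel_measurable M" "\<And>x. \<bar>f x\<bar> \<le> B"
  shows "integrable M f"
  using assms by (intro integrable_const_bound[of _ B]) auto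

lemma (in prob_space) abs_integral_le:
  fixes f :: "'a \<Rightarrow> real"
  assumes "f \<in> borel_measurable M" "\<And>x. \<bar>f x\<bar> \<le> B"
  shows "\<bar>\<integral>x. f x \<partial>M\<bar> \<le> B"
proof -
  have "\<bar>\<integral>x. f x \<partial>M\<bar> \<le> (\<integral>x. \<bar>f x\<bar> \<partial>M)"
    by (rule integral_abs_bound)
  also have "\<dots> \<le> (\<integral>x. B \<partial>M)"
    using assms by (intro integral_mono integrable_abs integrable_bounded[of f B]) auto
  finally show ?thesis
    by (simp add: prob_space)
qed

text \<open>Shifting \<open>f\<close> by \<open>B\<close> makes it nonnegative, so the identity for
  nonnegative integrals applies; all measures involved have mass 1, so the shift cancels.\<close>

lemma integral_bind_prob_algebra:
  fixes f :: "'b \<Rightarrow> real"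
  assumes M: "M \<in> space (prob_algebra N)" and K: "K \<in> N \<rightarrow>\<^sub>M prob_algebra L"
    and f: "f \<in> borel_measurable L" and B: "\<And>x. \<bar>f x\<bar> \<le> B"
  shows "(\<integral>y. f y \<partial>(M \<bind> K)) = (\<integral>x. \<integral>y. f y \<partial>K x \<partial>M)"
proof -
  interpret M: prob_space M
    using M by (simp add: space_prob_algebra)
  interpret MK: prob_space "M \<bind> K"
    using M K by (rule prob_space_bind')
  have setsM: "sets M = sets N"
    using M by (simp add: space_prob_algebra)
  have K': "K \<in> M \<rightarrow>\<^sub>M subprob_algebra L"
    using measurable_prob_algebraD[OF K] setsM by (simp cong: measurable_cong_sets)
  have Kx: "prob_space (K x)" "sets (K x) = sets L" if "x \<in> space M" for x
    using measurable_space[OF K, of x] that sets_eq_imp_space_eq[OF setsM]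
    by (auto simp: space_prob_algebra)
  have fK: "f \<in> borel_measurable (K x)" if "x \<in> space M" for x
    using f Kx(2)[OF that] by (simp cong: measurable_cong_sets)
  have fMK: "f \<in> borel_measurable (M \<bind> K)"
    using f sets_bind'[OF M K] by (simp cong: measurable_cong_sets)
  define g where "g = (\<lambda>y. f y + B)"
  have g0: "0 \<le> g y" for y
    using B[of y] by (auto simp: g_def)
  have gL: "g \<in> borel_measurable L"
    using f by (simp add: g_def)
  have gMK: "g \<in> borel_measurable (M \<bind> K)"
    using fMK by (simp add: g_def)
  have fint: "integrable (K x) f" if "x \<in> space M" for x
    using prob_space.integrable_bounded[OF Kx(1)[OF that] fK[OF that] B] .
  have gint: "integrable (K x) g" if "x \<in> space M" for x
    using fint[OF that] Kx(1)[OF that]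
    unfolding g_def by (intro Bochner_Integration.integrable_add) (auto simp: prob_space.finite_measure finite_measure.integrable_const)
  have meas: "(\<lambda>x. \<integral>y. h y \<partial>K x) \<in> borel_measurable M" if "h \<in> borel_measurable L" for h :: "'b \<Rightarrow> real"
    using measurable_compose[OF K' integral_measurable_subprob_algebra[OF that]] .
  have "(\<integral>y. g y \<partial>(M \<bind> K)) = enn2real (\<integral>\<^sup>+ y. g y \<partial>(M \<bind> K))"
    using gMK g0 by (intro integral_eq_nn_integral) auto
  also have "(\<integral>\<^sup>+ y. g y \<partial>(M \<bind> K)) = (\<integral>\<^sup>+x. \<integral>\<^sup>+y. g y \<partial>K x \<partial>M)"
    using gL by (intro nn_integral_bind[OF _ K']) auto
  also have "\<dots> = (\<integral>\<^sup>+x. ennreal (\<integral>y. g y \<partial>K x) \<partial>M)"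
    using g0 gint by (intro nn_integral_cong nn_integral_eq_integral) auto
  also have "enn2real \<dots> = (\<integral>x. \<integral>y. g y \<partial>K x \<partial>M)"
    using g0 meas[OF gL] by (intro integral_eq_nn_integral[symmetric]) auto
  finally have "(\<integral>y. g y \<partial>(M \<bind> K)) = (\<integral>x. \<integral>y. g y \<partial>K x \<partial>M)" .
  moreover have "(\<integral>y. g y \<partial>(M \<bind> K)) = (\<integral>y. f y \<partial>(M \<bind> K)) + B"
    using MK.integrable_bounded[OF fMK B] by (simp add: g_def MK.prob_space)
  moreover have "(\<integral>x. \<integral>y. g y \<partial>K x \<partial>M) = (\<integral>x. (\<integral>y. f y \<partial>K x) + B \<partial>M)"
    using fint Kx(1) by (intro Bochner_Integration.integral_cong)
      (auto simp: g_def prob_space.finite_measure finite_measure.integrable_const prob_space.prob_space)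
  moreover have "\<dots> = (\<integral>x. \<integral>y. f y \<partial>K x \<partial>M) + B"
  proof -
    have "\<bar>\<integral>y. f y \<partial>K x\<bar> \<le> B" if "x \<in> space M" for x
      using prob_space.abs_integral_le[OF Kx(1)[OF that] fK[OF that] B] .
    then have "integrable M (\<lambda>x. \<integral>y. f y \<partial>K x)"
      using meas[OF f] by (intro M.integrable_const_bound[of _ B]) auto
    then show ?thesis
      by (simp add: M.prob_space)
  qed
  ultimately show ?thesis
    by simp
qed

text \<open>A Fatou lemma for setwise converging measures. A simple function takes finitely many
  values, so its integrals converge, and the integral of \<open>f\<close> is the supremum over
  simple functions below it. Those with finite values suffice, and for them multiplication by a
  value preserves limits in \<open>ennreal\<close>.\<close>

lemma nn_integral_le_of_setwise_tendsto:
  assumes sets: "\<And>k. sets (M k) = sets N"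
    and lim: "\<And>A. A \<in> sets N \<Longrightarrow> (\<lambda>k. emeasure (M k) A) \<longlonglongrightarrow> emeasure N A"
    and bound: "\<And>k::nat. (\<integral>\<^sup>+x. f x \<partial>M k) \<le> B k" and B: "B \<longlonglongrightarrow> b"
  shows "(\<integral>\<^sup>+x. f x \<partial>N) \<le> b"
  unfolding nn_integral_def_finite
proof (safe intro!: SUP_least)
  fix g assume g: "simple_function N g" "g \<le> f" "\<forall>x. g x < top"
  have sp: "space (M k) = space N" for k
    using sets by (rule sets_eq_imp_space_eq)
  have gM: "simple_function (M k) g" for k
    using g(1) sets sp by (simp add: simple_function_def)
  have "(\<lambda>k. integral\<^sup>S (M k) g) \<longlonglongrightarrow> integral\<^sup>S N g"
    unfolding simple_integral_def sp
  proof (intro tendsto_sum ennreal_tendsto_cmult lim)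
    fix y assume "y \<in> g ` space N"
    then show "y < top" "g -` {y} \<inter> space N \<in> sets N"
      using g by (auto simp: simple_function_def)
  qed
  moreover have "integral\<^sup>S (M k) g \<le> B k" for k
  proof -
    have "integral\<^sup>S (M k) g = integral\<^sup>N (M k) g"
      using gM by (rule nn_integral_eq_simple_integral[symmetric])
    also have "\<dots> \<le> integral\<^sup>N (M k) f"
      using g(2) by (intro nn_integral_mono) (auto simp: le_fun_def)
    finally show ?thesis
      using bound[of k] by simp
  qed
  ultimately show "integral\<^sup>S N g \<le> b"
    using B by (intro LIMSEQ_le) auto
qed

text \<open>Passing to complements reverses the inequality, because both total masses are 1.\<close>

lemma prob_measure_eqI_le:
  assumes p: "prob_space p" and q: "prob_space q" and sets: "sets p = sets q"
    and le: "\<And>A. A \<in> sets q \<Longrightarrow> emeasure p A \<le> emeasure q A"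
  shows "p = q"
proof (rule measure_eqI[OF sets])
  interpret p: prob_space p by (rule p)
  interpret q: prob_space q by (rule q)
  fix A assume "A \<in> sets p"
  then have A: "A \<in> sets q" using sets by simp
  have le': "measure p B \<le> measure q B" if "B \<in> sets q" for B
    using le[OF that] by (simp add: p.emeasure_eq_measure q.emeasure_eq_measure)
  have "measure p (space q - A) = 1 - measure p A" "measure q (space q - A) = 1 - measure q A"
    using p.prob_compl[of A] q.prob_compl[of A] A sets sets_eq_imp_space_eq[OF sets] by auto
  then have "measure p A = measure q A"
    using le'[OF A] le'[of "space q - A"] A by auto
  then show "emeasure p A = emeasure q A"
    by (simp add: p.emeasure_eq_measure q.emeasure_eq_measure)
qed

text \<open>The limit set function is finitely additive; uniformity over sets lets it inherit
  continuity at the empty set, and with it countable additivity.\<close>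

lemma uniformly_Cauchy_prob_limit:
  assumes prob: "\<And>k::nat. prob_space (M k)" and sets: "\<And>k. sets (M k) = sets S"
    and cauchy: "uniformly_Cauchy_on (sets S) (\<lambda>k. measure (M k))"
  obtains N where "prob_space N" "sets N = sets S"
    "\<And>A. A \<in> sets S \<Longrightarrow> (\<lambda>k. measure (M k) A) \<longlonglongrightarrow> measure N A"
proof -
  interpret M: prob_space "M k" for k
    by (rule prob)
  have sp: "space (M k) = space S" for k
    using sets by (rule sets_eq_imp_space_eq)
  obtain l where l: "uniform_limit (sets S) (\<lambda>k. measure (M k)) l sequentially"
    using Cauchy_uniformly_convergent[OF cauchy] by (auto simp: uniformly_convergent_on_def)
  have lim: "(\<lambda>k. measure (M k) A) \<longlonglongrightarrow> l A" if "A \<in> sets S" for A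
    using tendsto_uniform_limitI[OF l that] .
  have nonneg: "0 \<le> l A" if "A \<in> sets S" for A
    using lim[OF that] by (rule LIMSEQ_le_const) auto
  have empty: "l {} = 0"
    using LIMSEQ_unique[OF lim[of "{}"], of 0] by simp
  have space: "l (space S) = 1"
    using LIMSEQ_unique[OF lim[of "space S"], of 1] M.prob_space by (simp add: sp)
  have add: "l (A \<union> B) = l A + l B" if "A \<in> sets S" "B \<in> sets S" "A \<inter> B = {}" for A B
  proof (rule LIMSEQ_unique[OF lim])
    show "(\<lambda>k. measure (M k) (A \<union> B)) \<longlonglongrightarrow> l A + l B"
      using tendsto_add[OF lim lim, OF that(1,2)] that by (simp add: M.finite_measure_Union sets)
  qed (use that in auto)
  have cont: "(\<lambda>i. l (A i)) \<longlonglongrightarrow> 0"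
    if A: "range A \<subseteq> sets S" "decseq A" "(\<Inter>i. A i) = {}" for A
  proof (rule LIMSEQ_I)
    fix r :: real assume r: "r > 0"
    \<comment> \<open>One \<open>k\<close> serves all sets \<open>A i\<close> at once; continuity
      from above of the single measure \<open>M k\<close> then does the rest.\<close>
    obtain k where k: "\<And>B. B \<in> sets S \<Longrightarrow> \<bar>measure (M k) B - l B\<bar> < r / 2"
      using uniform_limitD[OF l, of "r/2"] r by (auto simp: eventually_sequentially dist_real_def)
    have "(\<lambda>i. measure (M k) (A i)) \<longlonglongrightarrow> measure (M k) (\<Inter>i. A i)"
      using A by (intro M.finite_Lim_measure_decseq) (auto simp: sets)
    then have "(\<lambda>i. measure (M k) (A i)) \<longlonglongrightarrow> 0"
      using A by simp
    from LIMSEQ_D[OF this, of "r/2"] r obtain n0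
      where n0: "\<And>i. i \<ge> n0 \<Longrightarrow> measure (M k) (A i) < r/2" by auto
    have "norm (l (A i) - 0) < r" if "i \<ge> n0" for i
    proof -
      have "A i \<in> sets S" using A(1) by auto
      then show ?thesis
        using n0[OF that] k[of "A i"] nonneg[of "A i"]
        unfolding abs_less_iff real_norm_def by linarith
    qed
    then show "\<exists>no. \<forall>i\<ge>no. norm (l (A i) - 0) < r" by blast
  qed
  define N where "N = measure_of (space S) (sets S) (\<lambda>A. ennreal (l A))"
  have setsN: "sets N = sets S"
    by (simp add: N_def)
  have em: "emeasure N A = ennreal (l A)" if "A \<in> sets S" for A
  proof (rule emeasure_measure_of[OF N_def])
    show "sets S \<subseteq> Pow (space S)" by (rule sets.space_closed)
    show pos: "positive (sets N) (\<lambda>A. ennreal (l A))"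
      by (simp add: positive_def empty)
    show "countably_additive (sets N) (\<lambda>A. ennreal (l A))"
      unfolding setsN
    proof (rule sets.empty_continuous_imp_countably_additive)
      show "positive (sets S) (\<lambda>A. ennreal (l A))"
        using pos setsN by simp
      show "additive (sets S) (\<lambda>A. ennreal (l A))"
        using add nonneg by (auto simp: additive_def ennreal_plus[symmetric] simp del: ennreal_plus)
      show "(\<lambda>i. ennreal (l (A i))) \<longlonglongrightarrow> 0"
        if "range A \<subseteq> sets S" "decseq A" "(\<Inter>i. A i) = {}" for A
        using tendsto_ennrealI[OF cont[OF that]] by simp
    qed auto
  qed (use that setsN in auto)
  show thesis
  proof (rule that)
    show "prob_space N"
      by (rule prob_spaceI) (simp add: em space sets_eq_imp_space_eq[OF setsN])
    show "sets N = sets S" by (rule setsN)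
    show "(\<lambda>k. measure (M k) A) \<longlonglongrightarrow> measure N A" if "A \<in> sets S" for A
      using lim[OF that] em[OF that] nonneg[OF that] by (simp add: measure_def)
  qed
qed


text \<open>By homogeneity: dividing by \<open>b\<close> makes \<open>g\<close> an admissible test
  function, and \<open>b = 0\<close> forces \<open>g = 0\<close>.\<close>

lemma tv_norm_diff_bound:
  fixes g :: "'a::topological_space \<Rightarrow> real"
  assumes tv: "tv_norm_diff p q \<le> ennreal t" and t: "0 \<le> t"
    and g: "g \<in> borel_measurable borel" "\<And>x. \<bar>g x\<bar> \<le> b"
  shows "\<bar>(\<integral>x. g x \<partial>p) - (\<integral>x. g x \<partial>q)\<bar> \<le> b * t"
proof (cases "b = 0")
  case True
  then have "g = (\<lambda>x. 0)" using g(2) by auto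
  with True show ?thesis by simp
next
  case False
  then have b: "b > 0" using g(2)[of undefined] by linarith
  let ?h = "\<lambda>x. g x / b"
  have "ennreal \<bar>(\<integral>x. ?h x \<partial>p) - (\<integral>x. ?h x \<partial>q)\<bar> \<le> tv_norm_diff p q"
    unfolding tv_norm_diff_def
  proof (rule SUP_upper)
    show "?h \<in> {\<phi> \<in> borel_measurable borel. \<forall>x. \<bar>\<phi> x\<bar> \<le> 1}"
      using g b by auto
  qed
  then have "ennreal \<bar>(\<integral>x. ?h x \<partial>p) - (\<integral>x. ?h x \<partial>q)\<bar> \<le> ennreal t"
    using tv by (rule order_trans)
  then have "\<bar>(\<integral>x. g x \<partial>p) / b - (\<integral>x. g x \<partial>q) / b\<bar> \<le> t"
    using t by simp
  then show ?thesis
    using b by (simp add: diff_divide_distrib[symmetric] abs_divide field_simps)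
qed

section \<open>Drift and contraction\<close>

locale harris_transitions = transition_probabilities P
  for P :: "real \<Rightarrow> 'a::polish_space \<Rightarrow> real \<Rightarrow> 'a measure" +
  fixes V :: "'a \<Rightarrow> ennreal" and \<gamma> C :: real
  assumes V_meas: "V \<in> borel_measurable borel"
    and V_finite_nonempty: "{x. V x < \<infinity>} \<noteq> {}"
    and \<gamma>_pos: "0 < \<gamma>" and \<gamma>_less_1: "\<gamma> < 1" and C_pos: "C > 0"
    and drift_1: "\<And>(x::'a) (n::int).
      (\<integral>\<^sup>+ y. V y \<partial>P (of_int (n - 1)) x (of_int n)) \<le> ennreal \<gamma> * V x + ennreal C"
    and minorization: "\<And>R::real. R > 0 \<Longrightarrow>
      \<exists>(n0::nat) (\<delta>::real). n0 \<ge> 1 \<and> 0 < \<delta> \<and> \<delta> < 1 \<and>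
        (\<forall>n::int. (SUP (x, y) \<in> {(x, y). V x + V y \<le> ennreal R}.
           tv_norm_diff (P (of_int (n - int n0)) x (of_int n)) (P (of_int (n - int n0)) y (of_int n)))
         \<le> ennreal (2 * (1 - \<delta>)))"
begin

section \<open>Kernels over \<open>k\<close> time steps and the iterated drift condition\<close>

text \<open>Indexed by the final time and the number of steps, since a test function sits at time
  \<open>n\<close> while the starting time moves into the past.\<close>

definition Q :: "int \<Rightarrow> nat \<Rightarrow> 'a \<Rightarrow> 'a measure" where
  "Q n k x = P (of_int (n - int k)) x (of_int n)"

text \<open>The fixed point of \<open>r \<mapsto> \<gamma> * r + C\<close>, so the additive constant
  of the drift bound stays the same however many steps are taken.\<close>

definition K :: real where "K = C / (1 - \<gamma>)"

text \<open>The value is 0 where \<open>V\<close> is infinite, so bounds on functions in terms of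
  \<open>v\<close> are stated only where \<open>V\<close> is finite.\<close>

definition v :: "'a \<Rightarrow> real" where "v x = enn2real (V x)"

lemma K_pos: "K > 0"
  using \<gamma>_less_1 C_pos by (simp add: K_def)

lemma K_eq: "\<gamma> * K + C = K"
  using \<gamma>_less_1 by (simp add: K_def field_simps)

lemma v_meas [measurable]: "v \<in> borel_measurable borel"
  using V_meas unfolding v_def[abs_def] by measurable

lemma v_nonneg [simp]: "0 \<le> v x"
  by (simp add: v_def)

lemma V_eq_v: "V x < \<infinity> \<Longrightarrow> V x = ennreal (v x)"
  by (simp add: v_def)

lemma Q_kernel: "Q n k \<in> borel \<rightarrow>\<^sub>M prob_algebra borel"
  unfolding Q_def[abs_def] by (rule kernel) simp

lemma Q_space: "Q n k x \<in> space (prob_algebra borel)"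
  using measurable_space[OF Q_kernel] by simp

lemma prob_Q: "prob_space (Q n k x)" and sets_Q: "sets (Q n k x) = sets borel"
  using Q_space[of n k x] by (auto simp: space_prob_algebra)

lemma space_Q [simp]: "space (Q n k x) = UNIV"
  using sets_eq_imp_space_eq[OF sets_Q] by simp

lemma Q_0: "Q n 0 x = return borel x"
  by (simp add: Q_def initial)

lemma Q_add: "Q n (j + k) x = Q (n - int k) j x \<bind> Q n k"
proof (rule measure_eqI)
  show "sets (Q n (j + k) x) = sets (Q (n - int k) j x \<bind> Q n k)"
    using sets_bind'[OF Q_space Q_kernel] by (simp add: sets_Q)
  fix A assume "A \<in> sets (Q n (j + k) x)"
  then have A: "A \<in> sets borel" by (simp add: sets_Q)
  have "emeasure (Q n (j + k) x) A = (\<integral>\<^sup>+ y. emeasure (Q n k y) A \<partial>Q (n - int k) j x)"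
    using chapman_kolmogorov[of "of_int (n - int (j + k))" "of_int (n - int k)" "of_int n" A x] A
    by (simp add: Q_def algebra_simps)
  then show "emeasure (Q n (j + k) x) A = emeasure (Q (n - int k) j x \<bind> Q n k) A"
    using emeasure_bind_prob_algebra[OF Q_space Q_kernel A] by simp
qed

lemma measurable_Q_integral:
  fixes f :: "'a \<Rightarrow> real"
  assumes "f \<in> borel_measurable borel"
  shows "(\<lambda>x. \<integral>y. f y \<partial>Q n k x) \<in> borel_measurable borel"
  using measurable_compose[OF measurable_prob_algebraD[OF Q_kernel] integral_measurable_subprob_algebra[OF assms]] .

lemma abs_Q_integral_le:
  fixes f :: "'a \<Rightarrow> real"
  assumes "f \<in> borel_measurable borel" "\<And>x. \<bar>f x\<bar> \<le> B"
  shows "\<bar>\<integral>y. f y \<partial>Q n k x\<bar> \<le> B"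
  using assms prob_Q by (intro prob_space.abs_integral_le) (auto simp: measurable_cong_sets[OF sets_Q refl])

lemma Q_add_integral:
  fixes f :: "'a \<Rightarrow> real"
  assumes "f \<in> borel_measurable borel" "\<And>x. \<bar>f x\<bar> \<le> B"
  shows "(\<integral>y. f y \<partial>Q n (j + k) x) = (\<integral>z. \<integral>y. f y \<partial>Q n k z \<partial>Q (n - int k) j x)"
  unfolding Q_add by (rule integral_bind_prob_algebra[OF Q_space Q_kernel assms])

text \<open>The induction splits off the last step, so its hypothesis is used at the earlier end
  time \<open>n - 1\<close>; \<open>K_eq\<close> keeps the constant at \<open>K\<close>.\<close>

lemma drift_nn: "(\<integral>\<^sup>+ y. V y \<partial>Q n k x) \<le> ennreal (\<gamma> ^ k) * V x + ennreal K"
proof (induction k arbitrary: n)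
  case 0
  show ?case
    using V_meas by (simp add: Q_0 nn_integral_return)
next
  case (Suc k)
  have Vm: "V \<in> borel_measurable (Q m j x)" for m j
    using V_meas by (simp add: measurable_cong_sets[OF sets_Q refl])
  have "(\<integral>\<^sup>+ y. V y \<partial>Q n (Suc k) x) = (\<integral>\<^sup>+ y. V y \<partial>(Q (n - 1) k x \<bind> Q n 1))"
    using Q_add[of n k 1 x] by simp
  also have "\<dots> = (\<integral>\<^sup>+ z. \<integral>\<^sup>+ y. V y \<partial>Q n 1 z \<partial>Q (n - 1) k x)"
    using measurable_prob_algebraD[OF Q_kernel] V_meas
    by (intro nn_integral_bind[where B=borel]) (auto simp: measurable_cong_sets[OF sets_Q refl])
  also have "\<dots> \<le> (\<integral>\<^sup>+ z. ennreal \<gamma> * V z + ennreal C \<partial>Q (n - 1) k x)"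
    using drift_1 by (intro nn_integral_mono) (simp add: Q_def)
  also have "\<dots> = ennreal \<gamma> * (\<integral>\<^sup>+ z. V z \<partial>Q (n - 1) k x) + ennreal C"
    using Vm prob_space.emeasure_space_1[OF prob_Q]
    by (simp add: nn_integral_add nn_integral_cmult)
  also have "\<dots> \<le> ennreal \<gamma> * (ennreal (\<gamma> ^ k) * V x + ennreal K) + ennreal C"
    using Suc.IH[of "n - 1"] by (intro add_mono mult_left_mono) auto
  also have "\<dots> = ennreal (\<gamma> ^ Suc k) * V x + ennreal (\<gamma> * K + C)"
    using \<gamma>_pos K_pos C_pos by (simp add: distrib_left ennreal_mult ennreal_plus mult.assoc add.assoc)
  finally show ?case
    by (simp only: K_eq)
qed

lemma
  assumes "V x < \<infinity>"
  shows nn_Q_finite: "(\<integral>\<^sup>+ y. V y \<partial>Q n k x) < \<infinity>"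
    and drift: "(\<integral>y. v y \<partial>Q n k x) \<le> \<gamma> ^ k * v x + K"
proof -
  have le: "(\<integral>\<^sup>+ y. V y \<partial>Q n k x) \<le> ennreal (\<gamma> ^ k * v x + K)"
    using drift_nn[of n k x] V_eq_v[OF assms] \<gamma>_pos K_pos by (simp add: ennreal_plus ennreal_mult)
  also have "\<dots> < \<infinity>" by simp
  finally show fin: "(\<integral>\<^sup>+ y. V y \<partial>Q n k x) < \<infinity>" .
  have "(\<integral>y. v y \<partial>Q n k x) = enn2real (\<integral>\<^sup>+ y. ennreal (v y) \<partial>Q n k x)"
    by (intro integral_eq_nn_integral) (auto simp: measurable_cong_sets[OF sets_Q refl])
  also have "\<dots> \<le> enn2real (ennreal (\<gamma> ^ k * v x + K))"
  proof (rule enn2real_mono)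
    have "(\<integral>\<^sup>+ y. ennreal (v y) \<partial>Q n k x) \<le> (\<integral>\<^sup>+ y. V y \<partial>Q n k x)"
      by (intro nn_integral_mono) (simp add: v_def ennreal_enn2real_if)
    with le show "(\<integral>\<^sup>+ y. ennreal (v y) \<partial>Q n k x) \<le> ennreal (\<gamma> ^ k * v x + K)" by simp
  qed simp
  finally show "(\<integral>y. v y \<partial>Q n k x) \<le> \<gamma> ^ k * v x + K"
    using \<gamma>_pos K_pos by (simp del: ennreal_plus)
qed

lemma
  assumes "sets p = sets borel" "(\<integral>\<^sup>+ x. V x \<partial>p) < \<infinity>"
  shows AE_V_finite: "AE x in p. V x < \<infinity>"
    and integrable_v: "integrable p v"
proof -
  have Vm: "V \<in> borel_measurable p"
    using V_meas by (simp add: measurable_cong_sets[OF assms(1) refl])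
  show "AE x in p. V x < \<infinity>"
    using nn_integral_PInf_AE[OF Vm] assms(2) by (simp add: top.not_eq_extremum less_top)
  have "(\<integral>\<^sup>+ x. ennreal (v x) \<partial>p) \<le> (\<integral>\<^sup>+ x. V x \<partial>p)"
    by (intro nn_integral_mono) (simp add: v_def ennreal_enn2real_if)
  then have "(\<integral>\<^sup>+ x. ennreal (v x) \<partial>p) < \<infinity>"
    using assms(2) by (rule order.strict_trans1)
  then show "integrable p v"
    by (intro integrableI_nonneg) (auto simp: measurable_cong_sets[OF assms(1) refl])
qed

text \<open>A pointwise estimate where \<open>V\<close> is finite is enough, because a finite
  integral of \<open>V\<close> gives all other points mass 0. It serves for the kernels
  \<open>Q\<close> as well as for the invariant measures.\<close>

lemma integral_deviation_le:
  fixes f :: "'a \<Rightarrow> real"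
  assumes p: "prob_space p" "sets p = sets borel" "(\<integral>\<^sup>+ x. V x \<partial>p) < \<infinity>"
    and f: "f \<in> borel_measurable borel" "\<And>x. \<bar>f x\<bar> \<le> B"
    and le: "\<And>x. V x < \<infinity> \<Longrightarrow> \<bar>f x - c\<bar> \<le> a + b * v x"
  shows "\<bar>(\<integral>x. f x \<partial>p) - c\<bar> \<le> a + b * (\<integral>x. v x \<partial>p)"
proof -
  interpret prob_space p by (rule p)
  have fp: "f \<in> borel_measurable p"
    using f by (simp add: measurable_cong_sets[OF p(2) refl])
  have int: "integrable p f" "integrable p v"
    using integrable_bounded[OF fp f(2)] integrable_v[OF p(2,3)] by auto
  have "\<bar>(\<integral>x. f x \<partial>p) - c\<bar> = \<bar>\<integral>x. f x - c \<partial>p\<bar>"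
    using int by (simp add: prob_space)
  also have "\<dots> \<le> (\<integral>x. \<bar>f x - c\<bar> \<partial>p)"
    by (rule integral_abs_bound)
  also have "\<dots> \<le> (\<integral>x. a + b * v x \<partial>p)"
    using int AE_V_finite[OF p(2,3)] le by (intro integral_mono_AE) (auto elim!: eventually_mono)
  also have "\<dots> = a + b * (\<integral>x. v x \<partial>p)"
    using int by (simp add: prob_space)
  finally show ?thesis .
qed

section \<open>The weighted oscillation seminorm\<close>

text \<open>Bounds the seminorm by \<open>b\<close> without forming a supremum. For
  \<open>b, \<beta> \<ge> 0\<close> it says that \<open>\<phi>\<close> is
  \<open>b\<close>-Lipschitz, on the points with \<open>V\<close> finite, for the metric of Hairer
  and Mattingly that is \<open>2 + \<beta> * (v x + v y)\<close> for
  \<open>x \<noteq> y\<close>.\<close>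

definition osc :: "real \<Rightarrow> real \<Rightarrow> ('a \<Rightarrow> real) \<Rightarrow> bool" where
  "osc \<beta> b \<phi> \<longleftrightarrow> (\<forall>x y. V x < \<infinity> \<longrightarrow> V y < \<infinity> \<longrightarrow> \<bar>\<phi> x - \<phi> y\<bar> \<le> b * (2 + \<beta> * (v x + v y)))"

lemma osc_mono:
  assumes "osc \<beta> a \<phi>" "a \<le> b" "0 \<le> \<beta>"
  shows "osc \<beta> b \<phi>"
  unfolding osc_def
proof (intro allI impI)
  fix x y assume "V x < \<infinity>" "V y < \<infinity>"
  with assms(1) have "\<bar>\<phi> x - \<phi> y\<bar> \<le> a * (2 + \<beta> * (v x + v y))"
    by (simp add: osc_def)
  also have "\<dots> \<le> b * (2 + \<beta> * (v x + v y))"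
    using assms(2,3) by (intro mult_right_mono) auto
  finally show "\<bar>\<phi> x - \<phi> y\<bar> \<le> b * (2 + \<beta> * (v x + v y))" .
qed

text \<open>With \<open>w = b + b * \<beta> * v\<close>, the hypothesis says that every
  \<open>\<phi> x - w x\<close> lies below every \<open>\<phi> y + w y\<close>; the supremum of the
  lower family is a possible \<open>c\<close>. This turns a bound on differences into a bound at one
  point, which can be integrated against a single measure.\<close>

lemma osc_centre:
  assumes "osc \<beta> b \<phi>"
  obtains c where "\<And>x. V x < \<infinity> \<Longrightarrow> \<bar>\<phi> x - c\<bar> \<le> b + b * \<beta> * v x"
proof -
  let ?F = "{x. V x < \<infinity>}"
  define c where "c = (SUP x\<in>?F. \<phi> x - (b + b * \<beta> * v x))"
  have upper: "\<phi> x - (b + b * \<beta> * v x) \<le> \<phi> y + (b + b * \<beta> * v y)" if "x \<in> ?F" "y \<in> ?F" for x y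
  proof -
    have "\<bar>\<phi> x - \<phi> y\<bar> \<le> b * (2 + \<beta> * (v x + v y))"
      using assms that by (auto simp: osc_def)
    then show ?thesis by (simp add: algebra_simps abs_le_iff)
  qed
  obtain x0 where x0: "x0 \<in> ?F" using V_finite_nonempty by blast
  have bdd: "bdd_above ((\<lambda>x. \<phi> x - (b + b * \<beta> * v x)) ` ?F)"
    using upper[OF _ x0] by (intro bdd_aboveI2) 
  show thesis
  proof (rule that)
    fix x assume "V x < \<infinity>"
    then have x: "x \<in> ?F" by simp
    have "\<phi> x - (b + b * \<beta> * v x) \<le> c"
      unfolding c_def by (rule cSUP_upper[OF x bdd])
    moreover have "c \<le> \<phi> x + (b + b * \<beta> * v x)"
      unfolding c_def using V_finite_nonempty upper[OF _ x] by (intro cSUP_least) auto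
    ultimately show "\<bar>\<phi> x - c\<bar> \<le> b + b * \<beta> * v x" by linarith
  qed
qed

text \<open>Both integrals are compared with the same centre \<open>c\<close>, and each costs its
  own drift bound. The constant 2 does not shrink in this way; that takes the minorization.\<close>

lemma osc_Q_drift:
  assumes \<phi>: "\<phi> \<in> borel_measurable borel" "\<And>x. \<bar>\<phi> x\<bar> \<le> B"
    and osc: "osc \<beta> b \<phi>" and b: "0 \<le> b" and \<beta>: "0 \<le> \<beta>"
    and fin: "V x < \<infinity>" "V y < \<infinity>"
  shows "\<bar>(\<integral>z. \<phi> z \<partial>Q n k x) - (\<integral>z. \<phi> z \<partial>Q n k y)\<bar> \<le> b * (2 + \<beta> * (\<gamma> ^ k * (v x + v y) + 2 * K))"
proof -
  obtain c where c: "\<And>x. V x < \<infinity> \<Longrightarrow> \<bar>\<phi> x - c\<bar> \<le> b + b * \<beta> * v x"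
    using osc_centre[OF osc] by blast
  have *: "\<bar>(\<integral>z. \<phi> z \<partial>Q n k u) - c\<bar> \<le> b + b * \<beta> * (\<gamma> ^ k * v u + K)" if "V u < \<infinity>" for u
  proof -
    have "\<bar>(\<integral>z. \<phi> z \<partial>Q n k u) - c\<bar> \<le> b + b * \<beta> * (\<integral>z. v z \<partial>Q n k u)"
      using integral_deviation_le[OF prob_Q sets_Q nn_Q_finite[OF that] \<phi> c] .
    also have "\<dots> \<le> b + b * \<beta> * (\<gamma> ^ k * v u + K)"
      using drift[OF that] b \<beta> by (intro add_left_mono mult_left_mono) auto
    finally show ?thesis .
  qed
  have "\<bar>(\<integral>z. \<phi> z \<partial>Q n k x) - (\<integral>z. \<phi> z \<partial>Q n k y)\<bar>
      \<le> (b + b * \<beta> * (\<gamma> ^ k * v x + K)) + (b + b * \<beta> * (\<gamma> ^ k * v y + K))"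
    using *[OF fin(1)] *[OF fin(2)] by linarith
  also have "\<dots> = b * (2 + \<beta> * (\<gamma> ^ k * (v x + v y) + 2 * K))"
    by (simp add: algebra_simps)
  finally show ?thesis .
qed

text \<open>Used for the time steps that do not fill a whole block: they cost a factor that does not
  grow with \<open>k\<close>.\<close>

lemma osc_Q:
  assumes \<phi>: "\<phi> \<in> borel_measurable borel" "\<And>x. \<bar>\<phi> x\<bar> \<le> B"
    and osc: "osc \<beta> b \<phi>" and b: "0 \<le> b" and \<beta>: "0 \<le> \<beta>"
  shows "osc \<beta> (b * (1 + \<beta> * K)) (\<lambda>x. \<integral>z. \<phi> z \<partial>Q n k x)"
  unfolding osc_def
proof (intro allI impI)
  fix x y assume fin: "V x < \<infinity>" "V y < \<infinity>"
  have "\<gamma> ^ k * (v x + v y) \<le> v x + v y"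
    using \<gamma>_pos \<gamma>_less_1 by (intro mult_left_le_one_le) (auto intro: power_le_one)
  then have "\<beta> * (\<gamma> ^ k * (v x + v y)) \<le> \<beta> * (v x + v y)"
    using \<beta> by (rule mult_left_mono)
  moreover have "0 \<le> \<beta> * K * (\<beta> * (v x + v y))"
    using \<beta> K_pos by simp
  ultimately have "2 + \<beta> * (\<gamma> ^ k * (v x + v y) + 2 * K) \<le> (1 + \<beta> * K) * (2 + \<beta> * (v x + v y))"
    by (simp add: algebra_simps)
  then have "b * (2 + \<beta> * (\<gamma> ^ k * (v x + v y) + 2 * K)) \<le> b * (1 + \<beta> * K) * (2 + \<beta> * (v x + v y))"
    using b by (simp add: mult_left_mono mult.assoc)
  with osc_Q_drift[OF \<phi> osc b \<beta> fin, of n k]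
  show "\<bar>(\<integral>z. \<phi> z \<partial>Q n k x) - (\<integral>z. \<phi> z \<partial>Q n k y)\<bar> \<le> b * (1 + \<beta> * K) * (2 + \<beta> * (v x + v y))"
    by linarith
qed

section \<open>Contraction over blocks and geometric decay\<close>

text \<open>The constants are chosen before \<open>n\<close> and \<open>\<phi>\<close>; this
  uniformity in time allows blocks ending at different times to be composed.\<close>

lemma contraction:
  obtains n0 :: nat and \<beta> \<alpha> :: real where "n0 \<ge> 1" "0 < \<beta>" "\<beta> \<le> 1" "0 < \<alpha>" "\<alpha> < 1"
    "\<And>n \<phi> B b. \<phi> \<in> borel_measurable borel \<Longrightarrow> (\<And>x. \<bar>\<phi> x\<bar> \<le> B) \<Longrightarrow> 0 \<le> b \<Longrightarrow> osc \<beta> b \<phi> \<Longrightarrow>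
      osc \<beta> (\<alpha> * b) (\<lambda>x. \<integral>z. \<phi> z \<partial>Q n n0 x)"
proof -
  \<comment> \<open>\<open>n0\<close> and \<open>\<delta>\<close> will depend on \<open>R\<close>,
    so \<open>R\<close> is fixed from \<open>K\<close> and \<open>\<gamma>\<close> alone: for
    \<open>s \<ge> R\<close> the additive \<open>2 * K\<close> uses up at most half of the gain
    \<open>(1 - \<gamma>) * s\<close>.\<close>
  define R where "R = 4 * K / (1 - \<gamma>)"
  have R: "R > 0" and KR: "2 * K = (1 - \<gamma>) / 2 * R"
    using K_pos \<gamma>_less_1 by (auto simp: R_def)
  obtain n0 :: nat and \<delta> :: real where n0: "n0 \<ge> 1" and \<delta>: "0 < \<delta>" "\<delta> < 1"
    and minor: "\<And>n::int. (SUP (x, y) \<in> {(x, y). V x + V y \<le> ennreal R}.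
           tv_norm_diff (P (of_int (n - int n0)) x (of_int n)) (P (of_int (n - int n0)) y (of_int n)))
         \<le> ennreal (2 * (1 - \<delta>))"
    using minorization[OF R] by blast
  have tv: "tv_norm_diff (Q n n0 x) (Q n n0 y) \<le> ennreal (2 * (1 - \<delta>))" if "V x + V y \<le> ennreal R" for n x y
    using minor[of n, THEN order_trans[rotated], OF SUP_upper[of "(x, y)"]] that
    unfolding Q_def by auto
  \<comment> \<open>So small that for \<open>s < R\<close> the drift terms, all of order
    \<open>\<beta>\<close>, sum to at most \<open>\<delta>\<close>, half of the
    \<open>2 * \<delta>\<close> gained from the minorization.\<close>
  define \<beta> where "\<beta> = \<delta> / (R + 2 * K + 1)"
  have \<beta>: "0 < \<beta>" "\<beta> \<le> 1" and \<beta>\<delta>: "\<beta> * (R + 2 * K) \<le> \<delta>"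
    using \<delta> R K_pos by (auto simp: \<beta>_def field_simps)
  \<comment> \<open>The rate left after absorbing \<open>2 * K\<close>, namely
    \<open>\<gamma> + (1 - \<gamma>) / 2\<close>.\<close>
  define \<theta> where "\<theta> = (1 + \<gamma>) / 2"
  have \<theta>: "0 < \<theta>" "\<theta> < 1"
    using \<gamma>_pos \<gamma>_less_1 by (auto simp: \<theta>_def)
  \<comment> \<open>\<open>\<alpha>'\<close> is the smallest rate with \<open>2 + \<beta> * \<theta> * s \<le> \<alpha>' * (2 + \<beta> * s)\<close> for all \<open>s \<ge> R\<close>.\<close>
  define \<alpha>' where "\<alpha>' = (2 + \<beta> * \<theta> * R) / (2 + \<beta> * R)"
  have "\<beta> * \<theta> * R < \<beta> * R"
    using \<beta> \<theta> R by simp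
  moreover have pos: "0 < \<beta> * R" "0 < \<beta> * \<theta> * R" using \<beta> \<theta> R by auto
  ultimately have \<alpha>': "\<alpha>' < 1"
    by (simp add: \<alpha>'_def)
  have \<alpha>'_eq: "\<alpha>' * (2 + \<beta> * R) = 2 + \<beta> * \<theta> * R"
    using pos by (simp add: \<alpha>'_def)
  have \<alpha>'_\<theta>: "\<theta> \<le> \<alpha>'"
    using \<theta> pos by (simp add: \<alpha>'_def field_simps)
  \<comment> \<open>\<open>\<alpha>'\<close> is the rate for large \<open>s\<close>; for small
    \<open>s\<close> the rate comes from
    \<open>2 * (1 - \<delta>) + \<delta> = 2 * (1 - \<delta> / 2)\<close>.\<close>
  define \<alpha> where "\<alpha> = max \<alpha>' (1 - \<delta> / 2)"
  have \<alpha>: "0 < \<alpha>" "\<alpha> < 1" "\<alpha>' \<le> \<alpha>" "1 - \<delta> / 2 \<le> \<alpha>"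
    using \<delta> \<alpha>' by (auto simp: \<alpha>_def)
  show thesis
  proof (rule that[OF n0 \<beta> \<alpha>(1,2)])
    fix n :: int and \<phi> :: "'a \<Rightarrow> real" and B b :: real
    assume \<phi>: "\<phi> \<in> borel_measurable borel" "\<And>x. \<bar>\<phi> x\<bar> \<le> B" and b: "0 \<le> b" and osc: "osc \<beta> b \<phi>"
    obtain c where c: "\<And>x. V x < \<infinity> \<Longrightarrow> \<bar>\<phi> x - c\<bar> \<le> b + b * \<beta> * v x"
      using osc_centre[OF osc] by blast
    show "osc \<beta> (\<alpha> * b) (\<lambda>x. \<integral>z. \<phi> z \<partial>Q n n0 x)"
      unfolding osc_def
    proof (intro allI impI)
      fix x y assume fin: "V x < \<infinity>" "V y < \<infinity>"
      define s where "s = v x + v y"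
      have s0: "0 \<le> s" by (simp add: s_def)
      \<comment> \<open>The block contracts \<open>V\<close> at least as well as one step does,
        which is why \<open>R\<close> could be chosen before \<open>n0\<close>.\<close>
      have \<gamma>n: "\<gamma> ^ n0 \<le> \<gamma>"
        using \<gamma>_pos \<gamma>_less_1 n0 power_decreasing[of 1 n0 \<gamma>] by simp
      show "\<bar>(\<integral>z. \<phi> z \<partial>Q n n0 x) - (\<integral>z. \<phi> z \<partial>Q n n0 y)\<bar> \<le> \<alpha> * b * (2 + \<beta> * (v x + v y))"
      proof (cases "R \<le> s")
        case True
        have "\<gamma> ^ n0 * s + 2 * K \<le> \<gamma> * s + (1 - \<gamma>) / 2 * s"
          unfolding KR using \<gamma>n s0 True \<gamma>_less_1 by (intro add_mono mult_right_mono mult_left_mono) auto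
        also have "\<dots> = \<theta> * s"
          by (simp add: \<theta>_def field_simps)
        finally have "\<beta> * (\<gamma> ^ n0 * s + 2 * K) \<le> \<beta> * (\<theta> * s)"
          using \<beta> by (intro mult_left_mono) auto
        \<comment> \<open>Equality holds at \<open>s = R\<close> by \<open>\<alpha>'_eq\<close>, and
          beyond \<open>R\<close> the right side grows at least as fast because
          \<open>\<theta> \<le> \<alpha>'\<close>.\<close>
        moreover have "2 + \<beta> * (\<theta> * s) \<le> \<alpha>' * (2 + \<beta> * s)"
        proof -
          have "\<beta> * ((\<alpha>' - \<theta>) * R) \<le> \<beta> * ((\<alpha>' - \<theta>) * s)"
            using \<alpha>'_\<theta> True \<beta> by (intro mult_left_mono) auto
          with \<alpha>'_eq show ?thesis by (simp add: algebra_simps)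
        qed
        moreover have "\<alpha>' * (2 + \<beta> * s) \<le> \<alpha> * (2 + \<beta> * s)"
          using \<alpha> \<beta> s0 by (intro mult_right_mono) auto
        ultimately have "b * (2 + \<beta> * (\<gamma> ^ n0 * s + 2 * K)) \<le> b * (\<alpha> * (2 + \<beta> * s))"
          using b by (intro mult_left_mono) auto
        with osc_Q_drift[OF \<phi> osc b less_imp_le[OF \<beta>(1)] fin, of n n0] show ?thesis
          by (simp add: s_def mult_ac)
      next
        case False
        have Vs: "V x + V y \<le> ennreal R"
          using V_eq_v[OF fin(1)] V_eq_v[OF fin(2)] False R
          by (simp add: s_def ennreal_plus[symmetric] del: ennreal_plus)
        \<comment> \<open>Truncating at level \<open>b\<close> leaves a remainder dominated by \<open>b * \<beta> * v\<close>.\<close>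
        define \<phi>1 where "\<phi>1 z = max (- b) (min b (\<phi> z - c))" for z
        define \<phi>2 where "\<phi>2 z = \<phi> z - c - \<phi>1 z" for z
        have m1: "\<phi>1 \<in> borel_measurable borel" and m2: "\<phi>2 \<in> borel_measurable borel"
          using \<phi>(1) unfolding \<phi>1_def[abs_def] \<phi>2_def[abs_def] by measurable
        have b1: "\<bar>\<phi>1 z\<bar> \<le> b" for z
          using b by (auto simp: \<phi>1_def)
        have b2: "\<bar>\<phi>2 z\<bar> \<le> B + \<bar>c\<bar> + b" for z
          using b1[of z] \<phi>(2)[of z] unfolding \<phi>2_def by linarith
        have b2v: "\<bar>\<phi>2 z - 0\<bar> \<le> 0 + b * \<beta> * v z" if "V z < \<infinity>" for z
        proof -
          have "0 \<le> b * \<beta> * v z" using b \<beta> by simp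
          then show ?thesis
            using c[OF that] unfolding \<phi>2_def \<phi>1_def by (simp add: max_def min_def abs_le_iff)
        qed
        have int2: "\<bar>\<integral>z. \<phi>2 z \<partial>Q n n0 u\<bar> \<le> b * \<beta> * (\<gamma> * v u + K)" if "V u < \<infinity>" for u
        proof -
          have "\<bar>(\<integral>z. \<phi>2 z \<partial>Q n n0 u) - 0\<bar> \<le> 0 + b * \<beta> * (\<integral>z. v z \<partial>Q n n0 u)"
            by (rule integral_deviation_le[OF prob_Q sets_Q nn_Q_finite[OF that] m2 b2 b2v])
          also have "\<gamma> ^ n0 * v u \<le> \<gamma> * v u"
            using \<gamma>n by (rule mult_right_mono) simp
          then have "0 + b * \<beta> * (\<integral>z. v z \<partial>Q n n0 u) \<le> b * \<beta> * (\<gamma> * v u + K)"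
            using drift[OF that, of n n0] b \<beta> by (simp add: mult_left_mono)
          finally show ?thesis by simp
        qed
        have split: "(\<integral>z. \<phi> z \<partial>Q n n0 u) = (\<integral>z. \<phi>1 z \<partial>Q n n0 u) + (\<integral>z. \<phi>2 z \<partial>Q n n0 u) + c" for u
        proof -
          interpret prob_space "Q n n0 u" by (rule prob_Q)
          have "integrable (Q n n0 u) \<phi>1" "integrable (Q n n0 u) \<phi>2"
            using m1 m2 by (auto intro!: integrable_bounded[OF _ b1] integrable_bounded[OF _ b2]
                simp: measurable_cong_sets[OF sets_Q refl])
          then have "(\<integral>z. \<phi>1 z + \<phi>2 z + c \<partial>Q n n0 u)
              = (\<integral>z. \<phi>1 z \<partial>Q n n0 u) + (\<integral>z. \<phi>2 z \<partial>Q n n0 u) + c"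
            using prob_space by simp
          then show ?thesis by (simp add: \<phi>2_def)
        qed
        have "\<bar>(\<integral>z. \<phi>1 z \<partial>Q n n0 x) - (\<integral>z. \<phi>1 z \<partial>Q n n0 y)\<bar> \<le> b * (2 * (1 - \<delta>))"
          using tv_norm_diff_bound[OF tv[OF Vs] _ m1 b1] \<delta> by simp
        then have "\<bar>(\<integral>z. \<phi> z \<partial>Q n n0 x) - (\<integral>z. \<phi> z \<partial>Q n n0 y)\<bar>
            \<le> b * (2 * (1 - \<delta>)) + b * \<beta> * (\<gamma> * v x + K) + b * \<beta> * (\<gamma> * v y + K)"
          using int2[OF fin(1)] int2[OF fin(2)] unfolding split by linarith
        also have "\<dots> = b * (2 * (1 - \<delta>) + \<beta> * (\<gamma> * s + 2 * K))"
          by (simp add: s_def algebra_simps)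
        also have "\<dots> \<le> b * (\<alpha> * (2 + \<beta> * s))"
        proof (intro mult_left_mono b)
          have "\<gamma> * s \<le> R"
            using False s0 \<gamma>_pos \<gamma>_less_1 mult_left_le_one_le[of s \<gamma>] by linarith
          then have "\<beta> * (\<gamma> * s + 2 * K) \<le> \<beta> * (R + 2 * K)"
            using \<beta> by (intro mult_left_mono) auto
          moreover have "0 \<le> \<alpha> * (\<beta> * s)"
            using \<alpha> \<beta> s0 by simp
          ultimately show "2 * (1 - \<delta>) + \<beta> * (\<gamma> * s + 2 * K) \<le> \<alpha> * (2 + \<beta> * s)"
            using \<beta>\<delta> \<alpha>(4) by (simp add: distrib_left)
        qed
        finally show ?thesis
          by (simp add: s_def mult_ac)
      qed
    qed
  qed
qed

text \<open>Write \<open>m = r + k * n0\<close>. The \<open>k\<close> blocks adjacent to time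
  \<open>n\<close> contract, and the \<open>r < n0\<close> steps before them cost the factor
  \<open>1 + \<beta> * K\<close> once.\<close>

lemma geometric_osc_decay:
  obtains \<beta> \<rho> D :: real where "0 < \<beta>" "\<beta> \<le> 1" "0 < \<rho>" "\<rho> < 1" "0 < D"
    "\<And>n m \<phi> B b. \<phi> \<in> borel_measurable borel \<Longrightarrow> (\<And>x. \<bar>\<phi> x\<bar> \<le> B) \<Longrightarrow> 0 \<le> b \<Longrightarrow> osc \<beta> b \<phi> \<Longrightarrow>
      osc \<beta> (D * \<rho> ^ m * b) (\<lambda>x. \<integral>z. \<phi> z \<partial>Q n m x)"
proof -
  obtain n0 :: nat and \<beta> \<alpha> :: real where n0: "n0 \<ge> 1" and \<beta>: "0 < \<beta>" "\<beta> \<le> 1" and \<alpha>: "0 < \<alpha>" "\<alpha> < 1"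
    and contr: "\<And>n \<phi> B b. \<phi> \<in> borel_measurable borel \<Longrightarrow> (\<And>x. \<bar>\<phi> x\<bar> \<le> B) \<Longrightarrow> 0 \<le> b \<Longrightarrow> osc \<beta> b \<phi> \<Longrightarrow>
      osc \<beta> (\<alpha> * b) (\<lambda>x. \<integral>z. \<phi> z \<partial>Q n n0 x)"
    using contraction by metis
  define \<rho> where "\<rho> = root n0 \<alpha>"
  have \<rho>: "0 < \<rho>" "\<rho> < 1" and \<rho>n: "\<rho> ^ n0 = \<alpha>"
    using \<alpha> n0 by (auto simp: \<rho>_def)
  \<comment> \<open>Dividing by \<open>\<alpha>\<close> pays for the incomplete block:
    \<open>m \<le> k * n0 + n0\<close> yields only
    \<open>\<alpha> ^ k \<le> \<rho> ^ m / \<alpha>\<close>.\<close>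
  define D where "D = (1 + \<beta> * K) / \<alpha>"
  have D: "D > 0"
    using \<beta> K_pos \<alpha> by (auto simp: D_def intro!: divide_pos_pos add_pos_pos)
  have iter: "osc \<beta> (\<alpha> ^ k * b) (\<lambda>x. \<integral>z. \<phi> z \<partial>Q n (k * n0) x)"
    if \<phi>: "\<phi> \<in> borel_measurable borel" "\<And>x. \<bar>\<phi> x\<bar> \<le> B" and b: "0 \<le> b" and osc: "osc \<beta> b \<phi>"
    for n k \<phi> B b
  proof (induction k)
    case 0
    show ?case using osc \<phi> by (simp add: Q_0 integral_return)
  next
    case (Suc k)
    \<comment> \<open>The new block is put before the others in time: it ends at
      \<open>n - k * n0\<close> and acts on the function already averaged over the later
      blocks.\<close>
    have "osc \<beta> (\<alpha> * (\<alpha> ^ k * b)) (\<lambda>x. \<integral>y. \<integral>z. \<phi> z \<partial>Q n (k * n0) y \<partial>Q (n - int (k * n0)) n0 x)"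
      using b \<alpha> by (intro contr[OF measurable_Q_integral abs_Q_integral_le[OF \<phi>] _ Suc] \<phi>) auto
    then show ?case
      by (simp add: Q_add_integral[OF \<phi>, symmetric] mult.assoc del: of_nat_mult)
  qed
  show thesis
  proof (rule that[OF \<beta> \<rho> D])
    fix n :: int and m :: nat and \<phi> :: "'a \<Rightarrow> real" and B b :: real
    assume \<phi>: "\<phi> \<in> borel_measurable borel" "\<And>x. \<bar>\<phi> x\<bar> \<le> B" and b: "0 \<le> b" and osc: "osc \<beta> b \<phi>"
    define k where "k = m div n0"
    define r where "r = m mod n0"
    have m: "m = r + k * n0" by (simp add: k_def r_def)
    have "r < n0" using n0 by (simp add: r_def)
    then have m_le: "m \<le> k * n0 + n0" using m by linarith
    have "osc \<beta> (\<alpha> ^ k * b * (1 + \<beta> * K)) (\<lambda>x. \<integral>y. \<integral>z. \<phi> z \<partial>Q n (k * n0) y \<partial>Q (n - int (k * n0)) r x)"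
      using b \<alpha> \<beta> by (intro osc_Q[OF measurable_Q_integral abs_Q_integral_le[OF \<phi>] iter[OF \<phi>]] \<phi> osc) auto
    then have "osc \<beta> (\<alpha> ^ k * b * (1 + \<beta> * K)) (\<lambda>x. \<integral>z. \<phi> z \<partial>Q n m x)"
      by (simp add: m Q_add_integral[OF \<phi>, symmetric] del: of_nat_mult)
    moreover have "\<alpha> ^ k * b * (1 + \<beta> * K) \<le> D * \<rho> ^ m * b"
    proof -
      have "\<alpha> ^ k * \<alpha> = \<rho> ^ (k * n0 + n0)"
        by (simp only: power_add power_mult mult.commute[of k n0] \<rho>n)
      also have "\<dots> \<le> \<rho> ^ m"
        using \<rho> by (intro power_decreasing m_le) auto
      finally have "\<alpha> ^ k \<le> \<rho> ^ m / \<alpha>"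
        using \<alpha> by (simp add: pos_le_divide_eq)
      then have "\<alpha> ^ k * (b * (1 + \<beta> * K)) \<le> \<rho> ^ m / \<alpha> * (b * (1 + \<beta> * K))"
        using b \<beta> K_pos by (intro mult_right_mono) auto
      then show ?thesis by (simp add: D_def mult_ac)
    qed
    ultimately show "osc \<beta> (D * \<rho> ^ m * b) (\<lambda>x. \<integral>z. \<phi> z \<partial>Q n m x)"
      by (rule osc_mono) (use \<beta> in simp)
  qed
qed

section \<open>Invariant sequences\<close>

lemma transition_op_Q: "transition_op P (of_int (n - int m)) (of_int n) \<nu> = \<nu> \<bind> Q n m"
  by (simp add: transition_op_def Q_def[abs_def])

lemma weighted_norm_le:
  fixes B :: real
  assumes "\<And>x. \<bar>f x\<bar> \<le> B"
  shows "weighted_norm V f \<le> ennreal B"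
  unfolding weighted_norm_def
proof (rule SUP_least)
  fix x
  have "ennreal \<bar>f x\<bar> * 1 \<le> ennreal B * (1 + V x)"
    using assms[of x] by (intro mult_mono ennreal_leI) auto
  then show "ennreal \<bar>f x\<bar> / (1 + V x) \<le> ennreal B"
    by (intro divide_le_posI_ennreal) (auto simp: mult.commute add_pos_nonneg)
qed

lemma weighted_quotient_eq: "V x < \<infinity> \<Longrightarrow> 0 \<le> r \<Longrightarrow> ennreal r / (1 + V x) = ennreal (r / (1 + v x))"
  using V_eq_v[of x] divide_ennreal[of r "1 + v x"] v_nonneg[of x]
  by (simp add: add_pos_nonneg ennreal_plus)

text \<open>For \<open>invariant_bind\<close>: indicators have weighted norm at most 1, so the test
  functions in the definition determine the measure.\<close>

lemma
  assumes "invariant_sequence P V \<mu>"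
  shows invariant_prob: "prob_space (\<mu> n)"
    and invariant_sets: "sets (\<mu> n) = sets borel"
    and invariant_finite: "(\<integral>\<^sup>+ x. V x \<partial>\<mu> n) < \<infinity>"
    and invariant_bind: "\<mu> (n - int m) \<bind> Q n m = \<mu> n"
proof -
  show prob: "prob_space (\<mu> n)" and sets: "sets (\<mu> n) = sets borel"
    and "(\<integral>\<^sup>+ x. V x \<partial>\<mu> n) < \<infinity>" for n
    using assms by (auto simp: invariant_sequence_def)
  have \<mu>: "\<mu> n \<in> space (prob_algebra borel)" for n
    using prob sets by (simp add: space_prob_algebra)
  have eq: "\<forall>f \<in> borel_measurable borel. weighted_norm V f \<le> 1 \<longrightarrow>
      (\<integral>x. f x \<partial>transition_op P (of_int m) (of_int n) (\<mu> m)) = (\<integral>x. f x \<partial>\<mu> n)" if "m < n" for m n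
    using assms that unfolding invariant_sequence_def by blast
  show "\<mu> (n - int m) \<bind> Q n m = \<mu> n"
  \<comment> \<open>The definition only speaks of strictly earlier times; for \<open>m = 0\<close>
    the kernel is the identity.\<close>
  proof (cases "m = 0")
    case True
    then have "Q n m = return borel" by (auto simp: Q_0)
    then show ?thesis using True sets by (simp add: bind_return'')
  next
    case False
    let ?p = "\<mu> (n - int m) \<bind> Q n m"
    have p: "prob_space ?p" "sets ?p = sets borel"
      using prob_space_bind'[OF \<mu> Q_kernel] sets_bind'[OF \<mu> Q_kernel] by auto
    have sp: "space ?p = UNIV" "space (\<mu> n) = UNIV"
      using sets_eq_imp_space_eq[OF p(2)] sets_eq_imp_space_eq[OF sets] by auto
    show ?thesis
    proof (rule measure_eqI)
      show "sets ?p = sets (\<mu> n)" using p sets by simp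
      fix A assume "A \<in> sets ?p"
      then have A: "A \<in> sets borel" using p by simp
      have "weighted_norm V (indicator A) \<le> ennreal 1"
        by (rule weighted_norm_le) (simp add: indicator_def)
      then have "(\<integral>x. indicator A x \<partial>?p) = (\<integral>x. indicator A x \<partial>\<mu> n :: real)"
        using eq[rule_format, of "n - int m" n "indicator A"] False A unfolding transition_op_Q by simp
      then have "measure ?p A = measure (\<mu> n) A"
        using sp by simp
      then show "emeasure ?p A = emeasure (\<mu> n) A"
        using p(1) prob by (simp add: finite_measure.emeasure_eq_measure prob_space.finite_measure)
    qed
  qed
qed

lemma invariant_sequenceI:
  assumes "\<And>n. prob_space (\<mu> n)" "\<And>n. sets (\<mu> n) = sets borel"
    and "\<And>n. (\<integral>\<^sup>+ x. V x \<partial>\<mu> n) < \<infinity>" and inv: "\<And>n m. \<mu> (n - int m) \<bind> Q n m = \<mu> n"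
  shows "invariant_sequence P V \<mu>"
proof -
  have "transition_op P (of_int m) (of_int n) (\<mu> m) = \<mu> n" if "m < n" for m n
    using transition_op_Q[of n "nat (n - m)" "\<mu> m"] inv[of n "nat (n - m)"] that by simp
  then show ?thesis
    using assms by (auto simp: invariant_sequence_def)
qed

section \<open>Rates of convergence and uniqueness\<close>

text \<open>By invariance the averaged function \<open>h\<close> has mean \<open>?c\<close> under
  \<open>\<mu> (n - int m)\<close>. So \<open>?c - h x\<close> is a mean of differences
  \<open>h y - h x\<close>, which the decayed seminorm controls, and bounded moments make the cost
  of averaging over \<open>y\<close> uniform in time.\<close>

lemma invariant_weighted_decay:
  assumes inv: "invariant_sequence P V \<mu>" and bdd: "bounded_V_moments V \<mu>"
  shows "\<exists>\<rho> M :: real. 0 < \<rho> \<and> \<rho> < 1 \<and> 0 < M \<and>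
    (\<forall>n m. \<forall>\<phi> \<in> borel_measurable borel. bounded (range \<phi>) \<longrightarrow>
      weighted_norm V (\<lambda>x. (\<integral>y. \<phi> y \<partial>Q n m x) - (\<integral>y. \<phi> y \<partial>\<mu> n))
        \<le> ennreal (M * \<rho> ^ m) * weighted_norm V (\<lambda>x. \<phi> x - (\<integral>y. \<phi> y \<partial>\<mu> n)))"
proof -
  obtain \<beta> \<rho> D :: real where \<beta>: "0 < \<beta>" "\<beta> \<le> 1" and \<rho>: "0 < \<rho>" "\<rho> < 1" and D: "0 < D"
    and decay: "\<And>n m \<phi> B b. \<phi> \<in> borel_measurable borel \<Longrightarrow> (\<And>x. \<bar>\<phi> x\<bar> \<le> B) \<Longrightarrow> 0 \<le> b \<Longrightarrow> osc \<beta> b \<phi> \<Longrightarrow>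
      osc \<beta> (D * \<rho> ^ m * b) (\<lambda>x. \<integral>z. \<phi> z \<partial>Q n m x)"
    using geometric_osc_decay by metis
  note prob = invariant_prob[OF inv] and sets = invariant_sets[OF inv] and fin = invariant_finite[OF inv]
  have \<mu>: "\<mu> n \<in> space (prob_algebra borel)" for n
    using prob sets by (simp add: space_prob_algebra)
  define E where "E = enn2real (SUP n. \<integral>\<^sup>+ x. V x \<partial>\<mu> n)"
  have E0: "0 \<le> E" by (simp add: E_def)
  have E: "(\<integral>x. v x \<partial>\<mu> n) \<le> E" for n
  proof -
    have "(\<integral>\<^sup>+ x. ennreal (v x) \<partial>\<mu> n) \<le> (\<integral>\<^sup>+ x. V x \<partial>\<mu> n)"
      by (intro nn_integral_mono) (simp add: v_def ennreal_enn2real_if)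
    also have "\<dots> \<le> (SUP n. \<integral>\<^sup>+ x. V x \<partial>\<mu> n)"
      by (rule SUP_upper) simp
    finally have "enn2real (\<integral>\<^sup>+ x. ennreal (v x) \<partial>\<mu> n) \<le> E"
      unfolding E_def using bdd by (intro enn2real_mono) (auto simp: bounded_V_moments_def)
    moreover have "(\<integral>x. v x \<partial>\<mu> n) = enn2real (\<integral>\<^sup>+ x. ennreal (v x) \<partial>\<mu> n)"
      by (intro integral_eq_nn_integral) (auto simp: measurable_cong_sets[OF sets refl])
    ultimately show ?thesis by simp
  qed
  \<comment> \<open>\<open>1 / \<beta>\<close> comes from comparing the weights \<open>1 + v\<close>
    and \<open>1 + \<beta> * v\<close>, and \<open>2 + E\<close> from integrating
    \<open>2 + \<beta> * v x + \<beta> * v y\<close> over \<open>y\<close>.\<close>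
  define M where "M = D * (2 + E) / \<beta>"
  have M: "0 < M" using D E0 \<beta> by (simp add: M_def)
  have "weighted_norm V (\<lambda>x. (\<integral>y. \<phi> y \<partial>Q n m x) - (\<integral>y. \<phi> y \<partial>\<mu> n))
        \<le> ennreal (M * \<rho> ^ m) * weighted_norm V (\<lambda>x. \<phi> x - (\<integral>y. \<phi> y \<partial>\<mu> n))"
    if \<phi>: "\<phi> \<in> borel_measurable borel" and bounded: "bounded (range \<phi>)" for n m and \<phi> :: "'a \<Rightarrow> real"
  proof -
    obtain B where B: "\<And>x. \<bar>\<phi> x\<bar> \<le> B"
      using bounded by (auto simp: bounded_iff)
    let ?c = "\<integral>y. \<phi> y \<partial>\<mu> n"
    define N where "N = enn2real (weighted_norm V (\<lambda>x. \<phi> x - ?c))"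
    have "weighted_norm V (\<lambda>x. \<phi> x - ?c) \<le> ennreal (B + \<bar>?c\<bar>)"
      using B by (intro weighted_norm_le order_trans[OF abs_triangle_ineq4] add_right_mono)
    then have W: "weighted_norm V (\<lambda>x. \<phi> x - ?c) = ennreal N"
      by (auto simp: N_def intro!: ennreal_enn2real[symmetric] le_less_trans[OF _ ennreal_less_top])
    have N0: "0 \<le> N" by (simp add: N_def)
    have pointwise: "\<bar>\<phi> x - ?c\<bar> \<le> N / \<beta> * (1 + \<beta> * v x)" if "V x < \<infinity>" for x
    proof -
      have "ennreal \<bar>\<phi> x - ?c\<bar> / (1 + V x) \<le> ennreal N"
        unfolding W[symmetric] weighted_norm_def by (rule SUP_upper) simp
      then have "\<bar>\<phi> x - ?c\<bar> / (1 + v x) \<le> N"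
        using N0 by (simp add: weighted_quotient_eq[OF that])
      then have "\<bar>\<phi> x - ?c\<bar> \<le> N * (1 + v x)"
        using v_nonneg[of x] by (simp add: pos_divide_le_eq add_pos_nonneg)
      also have "\<dots> \<le> N * ((1 + \<beta> * v x) / \<beta>)"
        using N0 \<beta> by (intro mult_left_mono) (auto simp: field_simps)
      finally show ?thesis by simp
    qed
    have "osc \<beta> (N / \<beta>) \<phi>"
      unfolding osc_def
    proof (intro allI impI)
      fix x y assume "V x < \<infinity>" "V y < \<infinity>"
      from pointwise[OF this(1)] pointwise[OF this(2)]
      have "\<bar>\<phi> x - \<phi> y\<bar> \<le> N / \<beta> * (1 + \<beta> * v x) + N / \<beta> * (1 + \<beta> * v y)"
        by linarith
      then show "\<bar>\<phi> x - \<phi> y\<bar> \<le> N / \<beta> * (2 + \<beta> * (v x + v y))"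
        by (simp only: distrib_left) (simp add: algebra_simps)
    qed
    define h where "h x = (\<integral>y. \<phi> y \<partial>Q n m x)" for x
    define G where "G = D * \<rho> ^ m * (N / \<beta>)"
    have G0: "0 \<le> G" using D \<rho> N0 \<beta> by (simp add: G_def)
    have osc_h: "osc \<beta> G h"
      unfolding G_def h_def[abs_def] using N0 \<beta> by (intro decay[OF \<phi> B] \<open>osc \<beta> (N / \<beta>) \<phi>\<close>) auto
    have h: "h \<in> borel_measurable borel" "\<And>x. \<bar>h x\<bar> \<le> B"
      unfolding h_def[abs_def] by (auto intro: measurable_Q_integral abs_Q_integral_le \<phi> B)
    have h_int: "(\<integral>y. h y \<partial>\<mu> (n - int m)) = ?c"
      unfolding h_def integral_bind_prob_algebra[OF \<mu> Q_kernel \<phi> B, symmetric] invariant_bind[OF inv] ..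
    have h_le: "\<bar>h x - ?c\<bar> \<le> M * \<rho> ^ m * N * (1 + v x)" if "V x < \<infinity>" for x
    proof -
      have "\<bar>h y - h x\<bar> \<le> G * (2 + \<beta> * v x) + G * \<beta> * v y" if "V y < \<infinity>" for y
        using osc_h \<open>V x < \<infinity>\<close> that by (auto simp: osc_def algebra_simps)
      then have "\<bar>?c - h x\<bar> \<le> G * (2 + \<beta> * v x) + G * \<beta> * (\<integral>y. v y \<partial>\<mu> (n - int m))"
        unfolding h_int[symmetric] by (rule integral_deviation_le[OF prob sets fin h])
      also have "\<dots> \<le> G * (2 + \<beta> * v x) + G * \<beta> * E"
        using E G0 \<beta> by (intro add_left_mono mult_left_mono) auto
      also have "\<dots> = G * (2 + \<beta> * v x + \<beta> * E)"
        by (simp add: algebra_simps)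
      also have "\<dots> \<le> G * ((2 + E) * (1 + v x))"
      proof (rule mult_left_mono[OF _ G0])
        have "\<beta> * v x \<le> v x" "\<beta> * E \<le> E" "0 \<le> E * v x"
          using \<beta> E0 by (auto intro: mult_left_le_one_le)
        then show "2 + \<beta> * v x + \<beta> * E \<le> (2 + E) * (1 + v x)"
          using v_nonneg[of x] unfolding ring_distribs by linarith
      qed
      also have "\<dots> = M * \<rho> ^ m * N * (1 + v x)"
        by (simp add: G_def M_def)
      finally show ?thesis by (simp add: abs_minus_commute)
    qed
    show ?thesis
      unfolding W weighted_norm_def[of V "\<lambda>x. (\<integral>y. \<phi> y \<partial>Q n m x) - ?c"]
    proof (rule SUP_least)
      fix x
      show "ennreal \<bar>(\<integral>y. \<phi> y \<partial>Q n m x) - ?c\<bar> / (1 + V x) \<le> ennreal (M * \<rho> ^ m) * ennreal N"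
      proof (cases "V x < \<infinity>")
        case True
        have "\<bar>h x - ?c\<bar> / (1 + v x) \<le> M * \<rho> ^ m * N"
          using h_le[OF True] v_nonneg[of x] by (simp add: pos_divide_le_eq add_pos_nonneg)
        then show ?thesis
          using N0 M \<rho> by (simp add: weighted_quotient_eq[OF True] ennreal_mult[symmetric] h_def ennreal_leI)
      next
        case False
        then have "V x = \<top>" by (simp flip: less_top)
        then show ?thesis by simp
      qed
    qed
  qed
  then show ?thesis using \<rho> M by blast
qed

text \<open>A test function bounded by 1 differs from its mean by at most 2, and reading the
  weighted norm at one point brings in \<open>1 + V x\<close>. Where \<open>V x\<close> is infinite,
  so is the right side, its coefficient being positive.\<close>

lemma tv_decay:
  assumes M: "0 < M" and \<rho>: "0 < \<rho>" and \<mu>: "prob_space (\<mu> n)" "sets (\<mu> n) = sets borel"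
    and decay: "\<And>\<phi>. \<phi> \<in> borel_measurable borel \<Longrightarrow> bounded (range \<phi>) \<Longrightarrow>
      weighted_norm V (\<lambda>x. (\<integral>y. \<phi> y \<partial>Q n m x) - (\<integral>y. \<phi> y \<partial>\<mu> n))
        \<le> ennreal (M * \<rho> ^ m) * weighted_norm V (\<lambda>x. \<phi> x - (\<integral>y. \<phi> y \<partial>\<mu> n))"
  shows "tv_norm_diff (Q n m x) (\<mu> n) \<le> ennreal (2 * M * \<rho> ^ m) * (1 + V x)"
proof (cases "V x < \<infinity>")
  case False
  then have "V x = \<top>" by (simp flip: less_top)
  then show ?thesis using M \<rho> by (simp add: ennreal_mult_top)
next
  case True
  have "ennreal \<bar>(\<integral>y. \<phi> y \<partial>Q n m x) - (\<integral>y. \<phi> y \<partial>\<mu> n)\<bar> \<le> ennreal (2 * M * \<rho> ^ m) * (1 + V x)"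
    if \<phi>: "\<phi> \<in> borel_measurable borel" "\<And>x. \<bar>\<phi> x\<bar> \<le> 1" for \<phi> :: "'a \<Rightarrow> real"
  proof -
    let ?c = "\<integral>y. \<phi> y \<partial>\<mu> n"
    have c: "\<bar>?c\<bar> \<le> 1"
      using \<phi> \<mu> by (intro prob_space.abs_integral_le) (auto simp: measurable_cong_sets[OF \<mu>(2) refl])
    have "weighted_norm V (\<lambda>x. \<phi> x - ?c) \<le> ennreal 2"
      using \<phi>(2) c by (intro weighted_norm_le order_trans[OF abs_triangle_ineq4])
        (simp add: add_mono[of _ "1::real" _ 1, simplified])
    moreover have "bounded (range \<phi>)"
      using \<phi>(2) by (auto simp: bounded_iff)
    moreover have "ennreal \<bar>(\<integral>y. \<phi> y \<partial>Q n m x) - ?c\<bar> / (1 + V x)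
        \<le> weighted_norm V (\<lambda>x. (\<integral>y. \<phi> y \<partial>Q n m x) - ?c)"
      unfolding weighted_norm_def by (rule SUP_upper) simp
    ultimately have "ennreal \<bar>(\<integral>y. \<phi> y \<partial>Q n m x) - ?c\<bar> / (1 + V x) \<le> ennreal (M * \<rho> ^ m) * ennreal 2"
      using decay[OF \<phi>(1)] by (meson order_trans mult_left_mono zero_le)
    then have "\<bar>(\<integral>y. \<phi> y \<partial>Q n m x) - ?c\<bar> / (1 + v x) \<le> M * \<rho> ^ m * 2"
      using M \<rho> by (simp add: weighted_quotient_eq[OF True] ennreal_mult[symmetric] del: ennreal_numeral)
    then have "\<bar>(\<integral>y. \<phi> y \<partial>Q n m x) - ?c\<bar> \<le> 2 * M * \<rho> ^ m * (1 + v x)"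
      using v_nonneg[of x] by (simp add: pos_divide_le_eq add_pos_nonneg mult_ac)
    moreover have "1 + V x = ennreal (1 + v x)"
      using V_eq_v[OF True] by (simp add: ennreal_plus)
    ultimately show ?thesis
      using M \<rho> by (simp add: ennreal_mult[symmetric] ennreal_leI del: ennreal_plus)
  qed
  then show ?thesis
    unfolding tv_norm_diff_def by (intro SUP_least) auto
qed

lemma invariant_tv_decay:
  assumes inv: "invariant_sequence P V \<mu>" and bdd: "bounded_V_moments V \<mu>"
  shows "\<exists>\<rho> M :: real. 0 < \<rho> \<and> \<rho> < 1 \<and> 0 < M \<and>
    (\<forall>n m x. tv_norm_diff (Q n m x) (\<mu> n) \<le> ennreal (M * \<rho> ^ m) * (1 + V x))"
proof -
  obtain \<rho> M :: real where \<rho>: "0 < \<rho>" "\<rho> < 1" and M: "0 < M" and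
    decay: "\<And>n m \<phi>. \<phi> \<in> borel_measurable borel \<Longrightarrow> bounded (range \<phi>) \<Longrightarrow>
      weighted_norm V (\<lambda>x. (\<integral>y. \<phi> y \<partial>Q n m x) - (\<integral>y. \<phi> y \<partial>\<mu> n))
        \<le> ennreal (M * \<rho> ^ m) * weighted_norm V (\<lambda>x. \<phi> x - (\<integral>y. \<phi> y \<partial>\<mu> n))"
    using invariant_weighted_decay[OF assms] by blast
  have "tv_norm_diff (Q n m x) (\<mu> n) \<le> ennreal (2 * M * \<rho> ^ m) * (1 + V x)" for n m x
    using tv_decay[OF M \<rho>(1) invariant_prob[OF inv] invariant_sets[OF inv] decay] .
  then show ?thesis
    using \<rho> M by (intro exI[of _ \<rho>] exI[of _ "2 * M"]) auto
qed

text \<open>Total variation is tested on indicators. The converging measures do not involve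
  \<open>\<mu>\<close>, and uniqueness rests on this.\<close>

lemma invariant_setwise_limit:
  assumes inv: "invariant_sequence P V \<mu>" and bdd: "bounded_V_moments V \<mu>"
    and x: "V x < \<infinity>" and A: "A \<in> sets borel"
  shows "(\<lambda>m. measure (Q n m x) A) \<longlonglongrightarrow> measure (\<mu> n) A"
proof -
  obtain \<rho> M :: real where \<rho>: "0 < \<rho>" "\<rho> < 1" and M: "0 < M" and
    tv: "\<And>n m x. tv_norm_diff (Q n m x) (\<mu> n) \<le> ennreal (M * \<rho> ^ m) * (1 + V x)"
    using invariant_tv_decay[OF inv bdd] by blast
  have "1 + V x = ennreal (1 + v x)"
    using V_eq_v[OF x] by (simp add: ennreal_plus)
  then have tv': "tv_norm_diff (Q n m x) (\<mu> n) \<le> ennreal (M * \<rho> ^ m * (1 + v x))" for m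
    using tv[of n m x] M \<rho> by (simp add: ennreal_mult del: ennreal_plus)
  have "\<bar>(\<integral>y. indicator A y \<partial>Q n m x) - (\<integral>y. indicator A y \<partial>\<mu> n)\<bar> \<le> 1 * (M * \<rho> ^ m * (1 + v x))" for m
    using M \<rho> A by (intro tv_norm_diff_bound[OF tv']) (auto simp: indicator_def)
  moreover have "space (\<mu> n) = UNIV"
    using sets_eq_imp_space_eq[OF invariant_sets[OF inv, of n]] by simp
  ultimately have le: "norm (measure (Q n m x) A - measure (\<mu> n) A) \<le> M * \<rho> ^ m * (1 + v x)" for m
    by simp
  have "(\<lambda>m. M * \<rho> ^ m * (1 + v x)) \<longlonglongrightarrow> 0"
    using \<rho> by (intro tendsto_mult_left_zero tendsto_mult_right_zero LIMSEQ_power_zero) auto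
  then have "(\<lambda>m. measure (Q n m x) A - measure (\<mu> n) A) \<longlonglongrightarrow> 0"
    by (rule Lim_null_comparison[rotated]) (use le in simp)
  then show ?thesis
    by (rule LIM_zero_cancel)
qed

lemma invariant_unique:
  assumes "invariant_sequence P V \<mu>" "bounded_V_moments V \<mu>"
    and "invariant_sequence P V \<nu>" "bounded_V_moments V \<nu>"
  shows "\<nu> = \<mu>"
proof
  fix n
  obtain x where x: "V x < \<infinity>" using V_finite_nonempty by blast
  show "\<nu> n = \<mu> n"
  proof (rule measure_eqI)
    show "sets (\<nu> n) = sets (\<mu> n)"
      by (simp add: invariant_sets[OF assms(1)] invariant_sets[OF assms(3)])
    fix A assume "A \<in> sets (\<nu> n)"
    then have A: "A \<in> sets borel"
      using invariant_sets[OF assms(3)] by simp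
    have "measure (\<nu> n) A = measure (\<mu> n) A"
      using invariant_setwise_limit[OF assms(3,4) x A] invariant_setwise_limit[OF assms(1,2) x A]
      by (rule LIMSEQ_unique)
    then show "emeasure (\<nu> n) A = emeasure (\<mu> n) A"
      using invariant_prob[OF assms(1), of n] invariant_prob[OF assms(3), of n]
      by (simp add: finite_measure.emeasure_eq_measure prob_space.finite_measure)
  qed
qed

section \<open>Existence as a limit from the remote past\<close>

text \<open>The process started from \<open>x\<close> at time \<open>n - k\<close> has at time
  \<open>n - m\<close> a mean of \<open>v\<close> of at most \<open>v x + K\<close>. The decay over
  the last \<open>m\<close> steps compares it with the process started from \<open>x\<close> at time
  \<open>n - m\<close>, by a bound that is the same for all sets \<open>A\<close>.\<close>

lemma Q_uniformly_Cauchy: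
  assumes x: "V x < \<infinity>"
  shows "uniformly_Cauchy_on (sets borel) (\<lambda>k. measure (Q n k x))"
proof (rule uniformly_Cauchy_onI')
  obtain \<beta> \<rho> D :: real where \<beta>: "0 < \<beta>" "\<beta> \<le> 1" and \<rho>: "0 < \<rho>" "\<rho> < 1" and D: "0 < D"
    and decay: "\<And>n m \<phi> B b. \<phi> \<in> borel_measurable borel \<Longrightarrow> (\<And>x. \<bar>\<phi> x\<bar> \<le> B) \<Longrightarrow> 0 \<le> b \<Longrightarrow> osc \<beta> b \<phi> \<Longrightarrow>
      osc \<beta> (D * \<rho> ^ m * b) (\<lambda>x. \<integral>z. \<phi> z \<partial>Q n m x)"
    using geometric_osc_decay by metis
  \<comment> \<open>Bounds the mean of \<open>2 + \<beta> * v x + \<beta> * v y\<close> when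
    \<open>y\<close> is distributed as the process at the intermediate time.\<close>
  define L where "L = 2 + \<beta> * v x + \<beta> * (v x + K)"
  have bound: "dist (measure (Q n m x) A) (measure (Q n k x) A) \<le> D * \<rho> ^ m * L"
    if A: "A \<in> sets borel" and mk: "m < k" for A m k
  proof -
    define j where "j = k - m"
    have k: "k = j + m" using mk by (simp add: j_def)
    let ?\<phi> = "indicator A :: 'a \<Rightarrow> real"
    have \<phi>: "?\<phi> \<in> borel_measurable borel" "\<And>y. \<bar>?\<phi> y\<bar> \<le> 1"
      using A by (auto simp: indicator_def)
    have meas: "(\<integral>y. ?\<phi> y \<partial>Q n i z) = measure (Q n i z) A" for i z
      by simp
    \<comment> \<open>Values in \<open>[-1, 1]\<close> differ by at most the constant 2 of the
      weight, so the seminorm bound 1 suits every \<open>A\<close>.\<close>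
    have "osc \<beta> 1 ?\<phi>"
      unfolding osc_def
    proof (intro allI impI)
      fix y z
      have "0 \<le> \<beta> * (v y + v z)" using \<beta> by simp
      then show "\<bar>?\<phi> y - ?\<phi> z\<bar> \<le> 1 * (2 + \<beta> * (v y + v z))"
        using \<phi>(2)[of y] \<phi>(2)[of z] unfolding mult_1_left by linarith
    qed
    from decay[OF \<phi> _ this, of m n]
    have osc: "osc \<beta> (D * \<rho> ^ m) (\<lambda>y. measure (Q n m y) A)"
      by (simp add: meas)
    let ?G = "D * \<rho> ^ m"
    have G0: "0 \<le> ?G" using D \<rho> by simp
    have h: "(\<lambda>y. measure (Q n m y) A) \<in> borel_measurable borel" "\<And>y. \<bar>measure (Q n m y) A\<bar> \<le> 1"
      using measurable_Q_integral[OF \<phi>(1), of n m] prob_Q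
      by (auto simp: meas prob_space.prob_le_1)
    have "\<bar>measure (Q n m y) A - measure (Q n m x) A\<bar> \<le> ?G * (2 + \<beta> * v x) + ?G * \<beta> * v y" if "V y < \<infinity>" for y
      using osc x that by (auto simp: osc_def algebra_simps)
    then have "\<bar>(\<integral>y. measure (Q n m y) A \<partial>Q (n - int m) j x) - measure (Q n m x) A\<bar>
        \<le> ?G * (2 + \<beta> * v x) + ?G * \<beta> * (\<integral>y. v y \<partial>Q (n - int m) j x)"
      by (rule integral_deviation_le[OF prob_Q sets_Q nn_Q_finite[OF x] h])
    also have "(\<integral>y. measure (Q n m y) A \<partial>Q (n - int m) j x) = measure (Q n k x) A"
      using Q_add_integral[OF \<phi>, of n j m x] by (simp add: meas k)
    also have "?G * (2 + \<beta> * v x) + ?G * \<beta> * (\<integral>y. v y \<partial>Q (n - int m) j x) \<le> ?G * (2 + \<beta> * v x) + ?G * \<beta> * (v x + K)"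
    proof (intro add_left_mono mult_left_mono)
      have "\<gamma> ^ j * v x \<le> v x"
        using \<gamma>_pos \<gamma>_less_1 by (intro mult_left_le_one_le) (auto intro: power_le_one)
      then show "(\<integral>y. v y \<partial>Q (n - int m) j x) \<le> v x + K"
        using drift[OF x, of "n - int m" j] by linarith
    qed (use G0 \<beta> in auto)
    also have "\<dots> = ?G * L"
      by (simp add: L_def algebra_simps)
    finally show ?thesis
      by (simp add: dist_real_def abs_minus_commute)
  qed
  fix e :: real assume e: "e > 0"
  have "(\<lambda>m. D * \<rho> ^ m * L) \<longlonglongrightarrow> 0"
    using \<rho> by (intro tendsto_mult_left_zero tendsto_mult_right_zero LIMSEQ_power_zero) auto
  then have "\<forall>\<^sub>F m in sequentially. D * \<rho> ^ m * L < e"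
    using e by (intro order_tendstoD) auto
  then obtain m0 where "\<And>m. m \<ge> m0 \<Longrightarrow> D * \<rho> ^ m * L < e"
    by (auto simp: eventually_sequentially)
  then show "\<exists>M. \<forall>A\<in>sets borel. \<forall>m\<ge>M. \<forall>k>m. dist (measure (Q n m x) A) (measure (Q n k x) A) < e"
    using bound by (intro exI[of _ m0]) (blast intro: le_less_trans)
qed

text \<open>The measures are the setwise limits of \<open>Q n k x\<close> as \<open>k\<close> grows,
  with the same starting point \<open>x\<close> for every \<open>n\<close>.\<close>

lemma invariant_exists: "\<exists>\<mu>. invariant_sequence P V \<mu> \<and> bounded_V_moments V \<mu>"
proof -
  obtain x where x: "V x < \<infinity>" using V_finite_nonempty by blast
  have "\<exists>p. prob_space p \<and> sets p = sets borel \<and>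
      (\<forall>A\<in>sets borel. (\<lambda>k. measure (Q n k x) A) \<longlonglongrightarrow> measure p A)" for n
    by (rule uniformly_Cauchy_prob_limit[OF prob_Q sets_Q Q_uniformly_Cauchy[OF x, of n]]) auto
  then obtain \<mu> where prob: "\<And>n. prob_space (\<mu> n)" and sets: "\<And>n. sets (\<mu> n) = sets borel"
    and lim: "\<And>n A. A \<in> sets borel \<Longrightarrow> (\<lambda>k. measure (Q n k x) A) \<longlonglongrightarrow> measure (\<mu> n) A"
    by metis
  have \<mu>: "\<mu> n \<in> space (prob_algebra borel)" for n
    using prob sets by (simp add: space_prob_algebra)
  have elim: "(\<lambda>k. emeasure (Q n k x) A) \<longlonglongrightarrow> emeasure (\<mu> n) A" if "A \<in> sets borel" for n A
    using tendsto_ennrealI[OF lim[OF that, of n]] prob[of n] prob_Q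
    by (simp add: finite_measure.emeasure_eq_measure prob_space.finite_measure)
  \<comment> \<open>The drift bound survives the limit and does not depend on \<open>n\<close>,
    which gives the bounded moments.\<close>
  have V: "(\<integral>\<^sup>+ y. V y \<partial>\<mu> n) \<le> V x + ennreal K" for n
  proof (rule nn_integral_le_of_setwise_tendsto)
    fix k
    have "(\<integral>\<^sup>+ y. V y \<partial>Q n k x) \<le> ennreal (\<gamma> ^ k) * V x + ennreal K"
      by (rule drift_nn)
    also have "\<dots> \<le> 1 * V x + ennreal K"
      using \<gamma>_pos \<gamma>_less_1 by (intro add_right_mono mult_right_mono) (auto intro: power_le_one)
    finally show "(\<integral>\<^sup>+ y. V y \<partial>Q n k x) \<le> V x + ennreal K" by simp
  qed (use sets sets_Q elim in auto)
  have fin: "V x + ennreal K < \<infinity>" using x by simp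
  \<comment> \<open>The Fatou argument yields only an inequality on each set, which is enough
    between probability measures.\<close>
  have "\<mu> (n - int m) \<bind> Q n m = \<mu> n" for n m
  proof (rule prob_measure_eqI_le)
    show "prob_space (\<mu> (n - int m) \<bind> Q n m)" by (rule prob_space_bind'[OF \<mu> Q_kernel])
    show "sets (\<mu> (n - int m) \<bind> Q n m) = sets (\<mu> n)"
      using sets_bind'[OF \<mu> Q_kernel] sets by simp
    fix A assume "A \<in> sets (\<mu> n)"
    then have A: "A \<in> sets borel" using sets by simp
    have "(\<integral>\<^sup>+ y. emeasure (Q n m y) A \<partial>\<mu> (n - int m)) \<le> emeasure (\<mu> n) A"
    proof (rule nn_integral_le_of_setwise_tendsto)
      \<comment> \<open>\<open>k\<close> steps up to time \<open>n - m\<close> and \<open>m\<close>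
        more make \<open>k + m\<close> steps; the shifted sequence has the same limit.\<close>
      show "(\<integral>\<^sup>+ y. emeasure (Q n m y) A \<partial>Q (n - int m) k x) \<le> emeasure (Q n (k + m) x) A" for k
        unfolding Q_add using emeasure_bind_prob_algebra[OF Q_space Q_kernel A] by simp
      show "(\<lambda>k. emeasure (Q n (k + m) x) A) \<longlonglongrightarrow> emeasure (\<mu> n) A"
        using elim[OF A] by (rule LIMSEQ_ignore_initial_segment)
    qed (use sets sets_Q elim in auto)
    then show "emeasure (\<mu> (n - int m) \<bind> Q n m) A \<le> emeasure (\<mu> n) A"
      using emeasure_bind_prob_algebra[OF \<mu> Q_kernel A] by simp
  qed (rule prob)
  then have "invariant_sequence P V \<mu>"
    using prob sets le_less_trans[OF V fin] by (intro invariant_sequenceI)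
  moreover have "bounded_V_moments V \<mu>"
    unfolding bounded_V_moments_def using V fin by (auto intro!: le_less_trans[OF SUP_least])
  ultimately show ?thesis by blast
qed

end

theorem theorem3p13:
  fixes P :: "real \<Rightarrow> 'a::polish_space \<Rightarrow> real \<Rightarrow> 'a measure"
    and V :: "'a \<Rightarrow> ennreal"
    and \<gamma> C :: real
  assumes "transition_probabilities P"
    and "V \<in> borel_measurable borel"
    and "{x. V x < \<infinity>} \<noteq> {}"
    and "0 < \<gamma>" and "\<gamma> < 1" and "C > 0"
    and A1: "\<And>(x::'a) (n::int).
      (\<integral>\<^sup>+ y. V y \<partial>P (of_int (n - 1)) x (of_int n)) \<le> ennreal \<gamma> * V x + ennreal C"
    and A2: "\<And>R::real. R > 0 \<Longrightarrow>
      \<exists>(n0::nat) (\<delta>::real). n0 \<ge> 1 \<and> 0 < \<delta> \<and> \<delta> < 1 \<and>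
        (\<forall>n::int. (SUP (x, y) \<in> {(x, y). V x + V y \<le> ennreal R}.
           tv_norm_diff (P (of_int (n - int n0)) x (of_int n)) (P (of_int (n - int n0)) y (of_int n)))
         \<le> ennreal (2 * (1 - \<delta>)))"
  shows "\<exists>\<mu> :: int \<Rightarrow> 'a measure.
      invariant_sequence P V \<mu> \<and> bounded_V_moments V \<mu> \<and>
      (\<forall>\<nu>. invariant_sequence P V \<nu> \<and> bounded_V_moments V \<nu> \<longrightarrow> \<nu> = \<mu>) \<and>
      (\<exists>(\<alpha>::real) (M::real). 0 < \<alpha> \<and> \<alpha> < 1 \<and> M > 0 \<and>
        (\<forall>(n::int) (m::nat). \<forall>\<phi> \<in> borel_measurable borel. bounded (range \<phi>) \<longrightarrow>
           weighted_norm V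
             (\<lambda>x. (\<integral>y. \<phi> y \<partial>P (of_int (n - int m)) x (of_int n)) - (\<integral>y. \<phi> y \<partial>\<mu> n))
           \<le> ennreal (M * \<alpha> ^ m) * weighted_norm V (\<lambda>x. \<phi> x - (\<integral>y. \<phi> y \<partial>\<mu> n)))) \<and>
      (\<exists>(\<alpha>::real) (M'::real). 0 < \<alpha> \<and> \<alpha> < 1 \<and> M' > 0 \<and>
        (\<forall>(n::int) (m::nat) x.
           tv_norm_diff (P (of_int (n - int m)) x (of_int n)) (\<mu> n)
           \<le> ennreal (M' * \<alpha> ^ m) * (1 + V x)))"
proof -
  interpret harris_transitions P V \<gamma> C
    by (intro harris_transitions.intro harris_transitions_axioms.intro assms)
  obtain \<mu> where inv: "invariant_sequence P V \<mu>" "bounded_V_moments V \<mu>"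
    using invariant_exists by blast
  show ?thesis
  proof (intro exI[of _ \<mu>] conjI allI impI)
    show "\<nu> = \<mu>" if "invariant_sequence P V \<nu> \<and> bounded_V_moments V \<nu>" for \<nu>
      using invariant_unique[OF inv] that by blast
  qed (use inv invariant_weighted_decay[OF inv, unfolded Q_def]
      invariant_tv_decay[OF inv, unfolded Q_def] in blast)+
qed

end
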